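(* Let $\varepsilon>0$ and $z_1\ge 100$, and let $z_2=z_1^\tau$ for some real $\tau>1$. Define the Barban--Vehov weights, for positive integers $d$, $$\lambda_d=\mu(d)\,\frac{\log^+(z_2/d)-\log^+(z_1/d)}{\log(z_2/z_1)},$$ where $\mu$ is the Möbius function and $\log^+ t=\max\{\log t,0\}$. Then $$\sum_{n\ge 1}\frac{1}{n^{1+\varepsilon}}\Bigl(\sum_{d\mid n}\lambda_d\Bigr)^2\le \frac{e^{\gamma\varepsilon}}{\varepsilon\log(z_2/z_1)}\cdot\frac{A(\tau+1)+\bigl[B-\frac{C}{z_1^{\varepsilon}}+\bigl(B-\frac{C}{z_2^{\varepsilon}}\bigr)\tau^2\bigr]\varepsilon\log z_1}{\tau-1},$$ where $A=1.084$, $B=1.301$, $C=0.318$, and $\gamma$ is the Euler--Mascheroni constant. *)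

theory Defs
  imports "HOL-Analysis.Analysis" "HOL-Computational_Algebra.Squarefree"
begin

definition moebius_mu :: "nat \<Rightarrow> real" where
  "moebius_mu n = (if squarefree n then (-1) ^ card (prime_factors n) else 0)"

text \<open>Only used for \<open>t > 0\<close>, where \<open>ln\<close> is the natural logarithm.\<close>

definition log_plus :: "real \<Rightarrow> real" where
  "log_plus t = max (ln t) 0"

definition barban_vehov :: "real \<Rightarrow> real \<Rightarrow> nat \<Rightarrow> real" where
  "barban_vehov z1 z2 d =
     moebius_mu d * ((log_plus (z2 / real d) - log_plus (z1 / real d)) / ln (z2 / z1))"

end

theory Submission
  imports Defs
begin

text \<open>
  Write \<open>s = 1 + \<epsilon>\<close>. Opening the square gives \<open>\<zeta>(s)\<close> times a quadratic form in \<open>\<lambda>\<close>, which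
  \<open>gcd(d,e)\<^sup>s = \<Sum>\<^bsub>r | gcd(d,e)\<^esub> J\<^sub>s(r)\<close> diagonalises. Its coordinates are differences
  \<open>h\<^sub>r(z\<^sub>2/r) - h\<^sub>r(z\<^sub>1/r)\<close> of the sums
  \<open>h\<^sub>r(x) = \<Sum> \<mu>(m) m\<^bsup>-s\<^esup> log\<^sup>+(x/m)\<close> over \<open>m\<close> coprime to \<open>r\<close>. These satisfy
  \<open>0 \<le> h\<^sub>r(x) \<le> 1.082 (1 + \<epsilon> log x) r\<^sup>s / J\<^sub>s(r)\<close>, so the cross terms can be dropped, and bounding only
  one factor of each square leaves a sum that is linear in \<open>h\<^sub>r\<close> and is evaluated exactly by
  Moebius inversion. The upper bound \<open>1.082\<close> reduces to \<open>r = 1\<close>, \<open>\<epsilon> = 0\<close>, where it follows by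
  approximating \<open>log y\<close> by a combination of the harmonic sums \<open>H(y)\<close>, \<open>H(y/3)\<close> and of
  \<open>\<lfloor>y\<rfloor>/y\<close>, \<open>\<lfloor>y/3\<rfloor>/y\<close>, for all of which the sum against \<open>\<mu>(m)/m\<close> is explicit.
\<close>

section \<open>Sums of the Moebius function over divisors\<close>

text \<open>The constants leave little room. The product of 1.082 and the factor 1.0018 lost in
  bounding zeta(s) by exp(\<gamma> \<epsilon>) / \<epsilon> is just below A = 1.084. For the
  coefficient of \<epsilon> (log z)^2 this is not enough: the target is B - C / z^\<epsilon>, which
  falls to 0.983 when z^\<epsilon> is near 1. The missing tenth comes from the inversion itself. The
  weight 1 + \<epsilon> log(z/r) depends on r, so besides the term n = 1 the inversion leaves
  -\<epsilon> times a von Mangoldt sum; its primes are kept and bounded below by 0.0932 (log z)^2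
  z^(-\<epsilon>). The hypothesis \<open>z1 \<ge> 100\<close> enters through that bound.
  Nonnegativity of h_r matters twice: it gives the cross terms their sign, and it allows one factor
  of a square to be replaced by an upper bound. It survives the passage from r = 1, \<epsilon> = 0
  because both steps are positive operations: twisting by m^(-\<epsilon>) is an integral against a
  positive kernel, and removing a prime is a geometric series with positive coefficients. What
  remains is one function of x with limit 1 at infinity, to be kept between 0 and 1.082 for every x
  \<ge> 1.\<close>

lemma abs_moebius_mu_le_1: "\<bar>moebius_mu n\<bar> \<le> 1"
  by (simp add: moebius_mu_def power_abs)

lemma moebius_mu_1 [simp]: "moebius_mu (Suc 0) = 1"
  by (simp add: moebius_mu_def)

lemma moebius_mu_not_squarefree: "\<not> squarefree n \<Longrightarrow> moebius_mu n = 0"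
  by (simp add: moebius_mu_def)

lemma moebius_mu_sq: "squarefree n \<Longrightarrow> moebius_mu n * moebius_mu n = 1"
  by (simp add: moebius_mu_def flip: power_add)

lemma squarefree_pos: "squarefree (n::nat) \<Longrightarrow> n > 0"
  by (rule ccontr) auto

lemma squarefree_prime_mult_iff:
  fixes p d :: nat
  assumes "prime p"
  shows "squarefree (p * d) \<longleftrightarrow> squarefree d \<and> \<not> p dvd d"
proof
  assume sf: "squarefree (p * d)"
  have "\<not> p dvd d"
  proof
    assume "p dvd d"
    then have "p ^ 2 dvd p * d" by (simp add: power2_eq_square)
    then have "is_unit p" using sf squarefreeD by blast
    then show False using assms not_prime_unit by blast
  qed
  then show "squarefree d \<and> \<not> p dvd d"
    using sf squarefree_mono[of d "p * d"] by auto
next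
  assume "squarefree d \<and> \<not> p dvd d"
  then show "squarefree (p * d)"
    using assms by (intro squarefree_mult_coprime) (auto simp: squarefree_prime prime_imp_coprime)
qed

lemma prime_factors_prime_mult:
  fixes p d :: nat
  assumes "prime p" "d > 0"
  shows "prime_factors (p * d) = insert p (prime_factors d)"
  using assms by (auto simp: prime_factors_product prime_prime_factors)

lemma moebius_mu_prime_mult:
  assumes "prime p" "\<not> p dvd d"
  shows "moebius_mu (p * d) = - moebius_mu d"
proof (cases "squarefree d")
  case True
  then have "d > 0" by (rule squarefree_pos)
  moreover have "p \<notin> prime_factors d" using assms by auto
  ultimately show ?thesis
    using assms True
    by (simp add: moebius_mu_def squarefree_prime_mult_iff prime_factors_prime_mult)
next
  case False
  then show ?thesis
    using assms by (simp add: moebius_mu_def squarefree_prime_mult_iff)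
qed

text \<open>The squarefree divisors fall into pairs d, p * d with p not dividing d. Against \<mu>
  the two members of a pair have opposite signs, and against \<open>jordan\<close> they add up to a
  factor p^s.\<close>

lemma sum_squarefree_divisors_prime:
  fixes F :: "nat \<Rightarrow> real"
  assumes p: "prime p" "p dvd n" and n: "n > 0"
  shows "(\<Sum>d | d dvd n \<and> squarefree d. F d)
       = (\<Sum>d | d dvd n \<and> squarefree d \<and> \<not> p dvd d. F d + F (p * d))"
proof -
  let ?A = "{d. d dvd n \<and> squarefree d \<and> \<not> p dvd d}"
  have fin: "finite ?A" using n by (auto intro: finite_subset[OF _ finite_divisors_nat[of n]])
  have "p * d dvd n" if "d \<in> ?A" for d
    using that p prime_imp_coprime[of p d] by (auto intro: divides_mult)
  moreover have "d \<in> ?A \<union> (*) p ` ?A" if d: "d dvd n" "squarefree d" for d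
  proof (cases "p dvd d")
    case True
    then obtain e where e: "d = p * e" by (elim dvdE)
    then have "e \<in> ?A"
      using d p dvd_mult_right[of p e n] by (auto simp: squarefree_prime_mult_iff)
    with e show ?thesis by blast
  qed (use d in auto)
  ultimately have *: "{d. d dvd n \<and> squarefree d} = ?A \<union> (*) p ` ?A"
    using squarefree_prime_mult_iff[OF p(1)] by blast
  have "(\<Sum>d | d dvd n \<and> squarefree d. F d) = (\<Sum>d\<in>?A. F d) + (\<Sum>d\<in>(*) p ` ?A. F d)"
    unfolding * using fin by (intro sum.union_disjoint) auto
  also have "(\<Sum>d\<in>(*) p ` ?A. F d) = (\<Sum>d\<in>?A. F (p * d))"
    using p by (subst sum.reindex) (auto simp: inj_on_def)
  finally show ?thesis by (simp add: sum.distrib)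
qed

lemma sum_moebius_squarefree:
  assumes "n > 0"
  shows "(\<Sum>d | d dvd n. moebius_mu d * F d) = (\<Sum>d | d dvd n \<and> squarefree d. moebius_mu d * F d)"
  using assms by (intro sum.mono_neutral_right) (auto simp: moebius_mu_not_squarefree)

lemma sum_moebius_prime:
  assumes p: "prime p" "p dvd n" and n: "n > 0"
  shows "(\<Sum>d | d dvd n. moebius_mu d * F d)
       = (\<Sum>d | d dvd n \<and> squarefree d \<and> \<not> p dvd d. moebius_mu d * (F d - F (p * d)))"
  unfolding sum_moebius_squarefree[OF n] sum_squarefree_divisors_prime[OF assms]
  using p by (intro sum.cong) (auto simp: moebius_mu_prime_mult right_diff_distrib)

lemma sum_moebius_divisors:
  assumes "n > 0"
  shows "(\<Sum>d | d dvd n. moebius_mu d) = (if n = 1 then 1 else 0)"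
proof (cases "n = 1")
  case False
  then obtain p where "prime p" "p dvd n" using prime_factor_nat by blast
  with sum_moebius_prime[of p n "\<lambda>_. 1"] assms False show ?thesis by simp
qed simp

text \<open>The sum is minus the von Mangoldt function. Pairing d with p * d turns each pair into
  -\<mu>(d) ln p, where d runs over the squarefree divisors of the p-free part k; the remaining
  Moebius sum vanishes unless k = 1.\<close>

lemma sum_moebius_ln_divisors_le_0:
  assumes n: "n > 0"
  shows "(\<Sum>d | d dvd n. moebius_mu d * ln (real d)) \<le> 0"
proof (cases "n = 1")
  case False
  then obtain p where p: "prime p" "p dvd n" using prime_factor_nat by blast
  define k where "k = n div p ^ multiplicity p n"
  have pn: "n = p ^ multiplicity p n * k"
    unfolding k_def by (simp add: multiplicity_dvd)
  have k: "k > 0" using n pn by (metis gr0I mult_0_right less_irrefl)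
  have pk: "\<not> p dvd k"
    unfolding k_def using p n by (intro multiplicity_decompose) auto
  have "{d. d dvd n \<and> squarefree d \<and> \<not> p dvd d} = {d. d dvd k \<and> squarefree d}"
  proof (intro Collect_cong iffI)
    show "d dvd k \<and> squarefree d" if "d dvd n \<and> squarefree d \<and> \<not> p dvd d" for d
    proof -
      have "coprime d (p ^ multiplicity p n)"
        using that p by (metis coprime_commute coprime_power_left_iff prime_imp_coprime)
      with that show ?thesis using pn by (metis coprime_dvd_mult_right_iff)
    qed
    show "d dvd n \<and> squarefree d \<and> \<not> p dvd d" if "d dvd k \<and> squarefree d" for d
      using that pk pn by (metis dvd_mult dvd_trans)
  qed
  moreover have "(\<Sum>d | d dvd n. moebius_mu d * ln (real d))
      = (\<Sum>d | d dvd n \<and> squarefree d \<and> \<not> p dvd d. moebius_mu d * (ln (real d) - ln (real (p * d))))"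
    by (rule sum_moebius_prime) fact+
  moreover have "\<dots> = (\<Sum>d | d dvd n \<and> squarefree d \<and> \<not> p dvd d. moebius_mu d * - ln (real p))"
    using p by (intro sum.cong) (auto simp: ln_mult squarefree_pos prime_gt_0_nat)
  ultimately have "(\<Sum>d | d dvd n. moebius_mu d * ln (real d))
      = (\<Sum>d | d dvd k \<and> squarefree d. moebius_mu d * - ln (real p))" by simp
  also have "\<dots> = - ln (real p) * (if k = 1 then 1 else 0)"
    unfolding sum_moebius_squarefree[OF k, symmetric] sum_moebius_divisors[OF k, symmetric]
    by (simp add: sum_distrib_left mult.commute)
  finally show ?thesis using prime_ge_1_nat[OF p(1)] by simp
qed simp

lemma sum_moebius_ln_divisors_prime:
  assumes "prime p"
  shows "(\<Sum>d | d dvd p. moebius_mu d * ln (real d)) = - ln (real p)"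
proof -
  have "{d. d dvd p} = {1, p}"
    using assms by (auto simp: prime_nat_iff)
  moreover have "moebius_mu p = -1"
    using moebius_mu_prime_mult[of p 1] assms by (auto simp del: One_nat_def) simp
  ultimately show ?thesis using assms by (auto simp: prime_nat_iff)
qed

section \<open>Rearranging sums over pairs with m * n at most N\<close>

lemma sum_div_reindex:
  fixes h :: "nat \<Rightarrow> nat \<Rightarrow> real"
  shows "(\<Sum>m=1..N. \<Sum>n=1..N div m. h m n) = (\<Sum>k=1..N. \<Sum>m | m dvd k. h m (k div m))"
proof -
  have "(\<Sum>m=1..N. \<Sum>n=1..N div m. h m n) = (\<Sum>(m,n)\<in>(SIGMA m:{1..N}. {1..N div m}). h m n)"
    by (simp add: sum.Sigma)
  also have "\<dots> = (\<Sum>(k,m)\<in>(SIGMA k:{1..N}. {m. m dvd k}). h m (k div m))"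
  proof (rule sum.reindex_bij_witness[where i = "\<lambda>(k,m). (m, k div m)" and j = "\<lambda>(m,n). (m * n, m)"], goal_cases)
    case (4 a)
    then obtain k m where a: "a = (k, m)" "m dvd k" "1 \<le> k" "k \<le> N" by auto
    then have "1 \<le> m" "m \<le> N" "1 \<le> k div m"
      using dvd_imp_le[of m k] by (auto elim!: dvdE simp: Suc_le_eq)
    with a show ?case by (auto simp: div_le_mono)
  next
    case (2 a)
    then show ?case by (auto simp: less_eq_div_iff_mult_less_eq mult.commute)
  qed (auto elim!: dvdE)
  also have "\<dots> = (\<Sum>k=1..N. \<Sum>m | m dvd k. h m (k div m))"
    by (simp add: sum.Sigma)
  finally show ?thesis .
qed

text \<open>Collecting by k = m * n gives f(k) the weight of the Moebius sum over the divisors of k.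
  The cases f(k) = 1/k and f(k) = 1 produce the harmonic sums and the integer parts used
  below.\<close>

lemma sum_moebius_dilate:
  fixes f :: "nat \<Rightarrow> real"
  assumes "N \<ge> 1"
  shows "(\<Sum>m=1..N. moebius_mu m * (\<Sum>n=1..N div m. f (m * n))) = f 1"
proof -
  have "(\<Sum>m=1..N. moebius_mu m * (\<Sum>n=1..N div m. f (m * n)))
      = (\<Sum>k=1..N. \<Sum>m | m dvd k. moebius_mu m * f (m * (k div m)))"
    unfolding sum_distrib_left by (rule sum_div_reindex)
  also have "\<dots> = (\<Sum>k=1..N. f k * (\<Sum>m | m dvd k. moebius_mu m))"
    by (auto intro!: sum.cong simp: sum_distrib_left)
  also have "\<dots> = (\<Sum>k=1..N. if k = 1 then f k else 0)"
    using sum_moebius_divisors by (intro sum.cong) auto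
  also have "\<dots> = f 1" using assms by (subst sum.delta) auto
  finally show ?thesis .
qed

section \<open>Approximating the logarithm by harmonic sums\<close>

lemma ln_2_3_5_7_11_bounds:
  shows "ln (2::real) \<in> {0.69314..0.69315}" "ln (3::real) \<in> {1.09861..1.09862}"
    "ln (5::real) \<in> {1.60943..1.60945}" "ln (7::real) \<in> {1.9459..1.94592}"
    "ln (11::real) \<in> {2.39789..2.39792}"
proof -
  have 2: "ln (2::real) \<in> {0.693147..0.693148}"
    using ln_approx_bounds[of 2 7] by (simp add: eval_nat_numeral)
  then show "ln (2::real) \<in> {0.69314..0.69315}" by simp
  \<comment> \<open>The series behind \<open>ln_approx_bounds\<close> runs in powers of (x - 1) / (x
    + 1). The other primes are therefore reached through the ratios 3/2, 5/4, 8/7 and 11/10, which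
    lie close to 1 and need few terms.\<close>
  have "ln (3/2::real) \<in> {0.405465..0.405466}"
    using ln_approx_bounds[of "3/2" 5] by (simp add: eval_nat_numeral)
  moreover have "ln (3::real) = ln 2 + ln (3/2)" by (simp add: ln_div)
  ultimately show 3: "ln (3::real) \<in> {1.09861..1.09862}" using 2 by simp
  have "ln (5/4::real) \<in> {0.223143..0.223144}"
    using ln_approx_bounds[of "5/4" 4] by (simp add: eval_nat_numeral)
  moreover have "ln (5::real) = 2 * ln 2 + ln (5/4)" using ln_realpow[of 2 2] by (simp add: ln_div)
  ultimately have 5: "ln (5::real) \<in> {1.609437..1.60944}" using 2 by simp
  then show "ln (5::real) \<in> {1.60943..1.60945}" by simp
  have "ln (8/7::real) \<in> {0.13353..0.133532}"
    using ln_approx_bounds[of "8/7" 3] by (simp add: eval_nat_numeral)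
  moreover have "ln (7::real) = 3 * ln 2 - ln (8/7)" using ln_realpow[of 2 3] by (simp add: ln_div)
  ultimately show "ln (7::real) \<in> {1.9459..1.94592}" using 2 by simp
  have "ln (11/10::real) \<in> {0.09531..0.095311}"
    using ln_approx_bounds[of "11/10" 3] by (simp add: eval_nat_numeral)
  moreover have "ln (11::real) = ln 2 + ln 5 + ln (11/10)" using ln_mult[of 2 5] by (simp add: ln_div)
  ultimately show "ln (11::real) \<in> {2.39789..2.39792}" using 2 5 by simp
qed

text \<open>\<open>d\<close> is the error of the trapezoidal rule for the integral of 1/t over
  [n, n + 1]: nonnegative by convexity, and bounded by an expression that telescopes over n.\<close>

lemma trapezoid_ln_bounds:
  fixes n :: nat
  assumes "n \<ge> 1"
  defines "d \<equiv> 1 / (2 * real n) + 1 / (2 * (real n + 1)) - ln ((real n + 1) / real n)"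
  shows "0 \<le> d" "d \<le> 1 / 12 * (1 / real n ^ 2 - 1 / (real n + 1) ^ 2)"
proof -
  \<comment> \<open>ln((n + 1) / n) = 2 artanh v, so truncating the odd power series reduces both
    bounds to rational inequalities in v.\<close>
  define v where "v = 1 / (2 * real n + 1)"
  have v: "0 < v" "v < 1" "real n = (1 - v) / (2 * v)"
    using assms by (auto simp: v_def field_simps)
  have n: "real n > 0" using assms by simp
  have x: "((real n + 1) / real n - 1) / ((real n + 1) / real n + 1) = v"
    using n by (simp add: v_def field_simps)
  have v2: "0 < 1 - v\<^sup>2" using v by (simp add: power_less_one_iff abs_square_less_1)
  have tr: "1 / (2 * real n) + 1 / (2 * (real n + 1)) = 2 * v / (1 - v\<^sup>2)"
  proof -
    have "2 * real n = (1 - v) / v" using v by (simp add: field_simps)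
    then have "1 / (2 * real n) = v / (1 - v)" by simp
    moreover have "1 / (2 * (real n + 1)) = v / (1 + v)" using v by (simp add: field_simps)
    moreover have "1 - v\<^sup>2 = (1 - v) * (1 + v)" by (simp add: algebra_simps power2_eq_square)
    ultimately show ?thesis using v by (simp add: add_frac_eq algebra_simps)
  qed
  have sq: "1 / real n ^ 2 - 1 / (real n + 1) ^ 2 = 16 * v ^ 3 / (1 - v\<^sup>2) ^ 2"
  proof -
    have "1 / real n ^ 2 - 1 / (real n + 1) ^ 2 = (1 / real n) ^ 2 - (1 / (real n + 1)) ^ 2"
      by (simp add: power_divide)
    also have "1 / real n = 2 * v / (1 - v)" using v by simp
    also have "1 / (real n + 1) = 2 * v / (1 + v)" using v by (simp add: field_simps)
    also have "(2 * v / (1 - v)) ^ 2 - (2 * v / (1 + v)) ^ 2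
        = ((2 * v) ^ 2 * (1 + v) ^ 2 - (2 * v) ^ 2 * (1 - v) ^ 2) / ((1 - v) * (1 + v)) ^ 2"
      using v by (simp add: power_divide power_mult_distrib diff_frac_eq)
    also have "(1 - v) * (1 + v) = 1 - v\<^sup>2" by (simp add: algebra_simps power2_eq_square)
    also have "(2 * v) ^ 2 * (1 + v) ^ 2 - (2 * v) ^ 2 * (1 - v) ^ 2 = 16 * v ^ 3"
      by algebra
    finally show ?thesis .
  qed
  have "ln ((real n + 1) / real n) \<in> {2 * v .. 2 * v + 2 * (v ^ 3 / (1 - v\<^sup>2) / 3)}"
    using ln_approx_bounds[of "(real n + 1) / real n" 1, unfolded x] n
    by (simp add: algebra_simps power3_eq_cube power2_eq_square)
  then have "ln ((real n + 1) / real n) \<le> 2 * v + 2 * (v ^ 3 / (1 - v\<^sup>2) / 3)" by simp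
  also have "\<dots> \<le> 2 * v / (1 - v\<^sup>2)"
    using v v2 by (simp add: divide_simps) (simp add: algebra_simps power2_eq_square power3_eq_cube)
  finally show "0 \<le> d" unfolding d_def tr by simp
  have "2 * v + 2 * v ^ 3 / 3 \<le> ln ((real n + 1) / real n)"
    using ln_approx_bounds[of "(real n + 1) / real n" 2, unfolded x] n
    by (simp add: eval_nat_numeral algebra_simps add_divide_distrib)
  moreover have "2 * v / (1 - v\<^sup>2) - (2 * v + 2 * v ^ 3 / 3) \<le> 4 / 3 * v ^ 3 / (1 - v\<^sup>2) ^ 2"
  proof -
    have "4 / 3 * v ^ 3 / (1 - v\<^sup>2) ^ 2 - (2 * v / (1 - v\<^sup>2) - (2 * v + 2 * v ^ 3 / 3))
        = 2 / 3 * v ^ 5 * (1 + v\<^sup>2) / (1 - v\<^sup>2) ^ 2"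
      using v2 by (simp add: divide_simps) algebra
    also have "\<dots> \<ge> 0" using v v2 by simp
    finally show ?thesis by simp
  qed
  ultimately show "d \<le> 1 / 12 * (1 / real n ^ 2 - 1 / (real n + 1) ^ 2)"
    unfolding sq d_def tr by simp
qed

text \<open>By the trapezoid bounds \<open>u\<close> increases and its corrected version
  \<open>v\<close> decreases, both with limit \<open>euler_mascheroni\<close>; hence the constant
  lies between them at every index. The shift by one makes \<open>u (n - 1)\<close> the value at
  n.\<close>

lemma harm_approx:
  fixes n :: nat
  assumes "n \<ge> 1"
  defines "\<rho> \<equiv> ln (real n) + euler_mascheroni + 1 / (2 * real n) - harm n"
  shows "0 \<le> \<rho>" "\<rho> \<le> 1 / (12 * real n ^ 2)"
proof -
  define u :: "nat \<Rightarrow> real" where "u = (\<lambda>k. harm (Suc k) - ln (real (Suc k)) - 1 / (2 * real (Suc k)))"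
  define v where "v = (\<lambda>k. u k + 1 / 12 * (1 / real (Suc k) ^ 2))"
  have lim0: "(\<lambda>k. 1 / real (Suc k)) \<longlonglongrightarrow> 0"
    using LIMSEQ_inverse_real_of_nat by (simp add: inverse_eq_divide)
  have u: "u \<longlonglongrightarrow> euler_mascheroni"
    using tendsto_diff[OF LIMSEQ_Suc[OF euler_mascheroni_LIMSEQ] tendsto_mult[OF tendsto_const[of "1/2"] lim0]]
    by (simp add: u_def)
  have v: "v \<longlonglongrightarrow> euler_mascheroni"
    using tendsto_add[OF u tendsto_mult[OF tendsto_const[of "1/12"] tendsto_power[OF lim0, of 2]]]
    by (simp add: v_def power_divide)
  have step: "u (Suc k) - u k = 1 / (2 * real (Suc k)) + 1 / (2 * (real (Suc k) + 1))
      - ln ((real (Suc k) + 1) / real (Suc k))" for k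
  proof -
    have "u (Suc k) - u k = inverse (real (Suc (Suc k))) - ln (real (Suc (Suc k))) + ln (real (Suc k))
        - 1 / (2 * real (Suc (Suc k))) + 1 / (2 * real (Suc k))"
      by (simp add: u_def harm_Suc[of "Suc k"] del: of_nat_Suc)
    moreover have "ln ((real (Suc k) + 1) / real (Suc k)) = ln (real (Suc (Suc k))) - ln (real (Suc k))"
      by (subst ln_div) (auto simp: add_ac)
    moreover have "inverse (real (Suc (Suc k))) = 1 / (2 * real (Suc (Suc k))) + 1 / (2 * (real (Suc k) + 1))"
      by (simp add: field_simps)
    ultimately show ?thesis by linarith
  qed
  have "incseq u"
    using trapezoid_ln_bounds(1) step by (intro incseq_SucI) (smt (verit) le_add1 plus_1_eq_Suc)
  then have "u (n - 1) \<le> euler_mascheroni" using u by (rule incseq_le)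
  moreover have "v (Suc k) \<le> v k" for k
    using trapezoid_ln_bounds(2)[of "Suc k"] step[of k] by (simp add: v_def algebra_simps)
  then have "decseq v" by (rule decseq_SucI)
  then have "euler_mascheroni \<le> v (n - 1)" using v by (rule decseq_ge)
  ultimately show "0 \<le> \<rho>" "\<rho> \<le> 1 / (12 * real n ^ 2)"
    using assms by (auto simp: u_def v_def)
qed

text \<open>The upper end is 49/20 - ln 6 - 1/12 + 1/432, about 0.57724, from the harmonic estimate
  at n = 6; the lower end is 19/33.\<close>

lemma euler_mascheroni_bounds_3:
  "(euler_mascheroni :: real) \<in> {0.5757..0.5773}"
proof -
  have "ln (6::real) = ln 2 + ln 3" using ln_mult[of 2 3] by simp
  moreover have "(harm 6 :: real) = 49/20" by (simp add: harm_expand)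
  ultimately show ?thesis
    using harm_approx(2)[of 6] euler_mascheroni_gt_19_over_33 ln_2_3_5_7_11_bounds(1,2)
    by (simp add: power2_eq_square)
qed

section \<open>Enclosing y ln y on unit intervals by a tangent and a chord\<close>

lemma xlnx_ge_tangent:
  fixes t y l :: real
  assumes "t > 0" "y > 0" "l \<le> ln t"
  shows "y * (1 + l) - t \<le> y * ln y"
proof -
  have "ln (t / y) \<le> t / y - 1" using assms by (intro ln_le_minus_one) auto
  then have "y * (ln t - ln y) \<le> t - y" using assms by (simp add: ln_div field_simps)
  moreover have "y * l \<le> y * ln t" using assms by simp
  ultimately show ?thesis by (simp add: algebra_simps)
qed

lemma xlnx_le_chord:
  fixes y n a b :: real
  assumes "n > 0" "n \<le> y" "y \<le> n + 1" "ln n \<le> a" "ln (n + 1) \<le> b"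
  shows "y * ln y \<le> (n + 1 - y) * (n * a) + (y - n) * ((n + 1) * b)"
proof -
  have "convex_on {0<..} (\<lambda>x::real. x * ln x)"
    by (rule f''_ge0_imp_convex[where f' = "\<lambda>x. ln x + 1" and f'' = "\<lambda>x. 1 / x"])
      (auto intro!: derivative_eq_intros)
  from convex_onD[OF this, of "y - n" n "n + 1"] assms
  have "((1 - (y - n)) * n + (y - n) * (n + 1)) * ln ((1 - (y - n)) * n + (y - n) * (n + 1))
      \<le> (1 - (y - n)) * (n * ln n) + (y - n) * ((n + 1) * ln (n + 1))"
    by simp
  moreover have "(1 - (y - n)) * n + (y - n) * (n + 1) = y" by (simp add: algebra_simps)
  moreover have "(1 - (y - n)) * (n * ln n) \<le> (1 - (y - n)) * (n * a)"
    "(y - n) * ((n + 1) * ln (n + 1)) \<le> (y - n) * ((n + 1) * b)"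
    using assms by (auto intro!: mult_left_mono)
  ultimately show ?thesis by (simp add: algebra_simps)
qed

text \<open>
  The coefficients of the approximation
  \<open>log y \<approx> 1.386 H(y) - 0.386 H(y/3) + (- 1.43 \<lfloor>y\<rfloor> + b\<^sub>3 \<lfloor>y/3\<rfloor>) / y\<close>
  come from a linear program minimising the weighted size of the error. The harmonic coefficients
  add up to \<open>1\<close> and \<open>b\<^sub>3\<close> cancels the constant term at infinity, so \<open>log_err\<close>, which is \<open>y\<close> times
  the error with \<open>n = \<lfloor>y\<rfloor>\<close>, is bounded.
\<close>

definition b3 :: real where
  "b3 = 3 * (1.43 - euler_mascheroni - 0.386 * ln 3)"

definition log_err :: "nat \<Rightarrow> real \<Rightarrow> real" where
  "log_err n y = y * ln y - y * (1.386 * harm n - 0.386 * harm (n div 3)) + 1.43 * real n - b3 * real (n div 3)"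

lemma b3_bounds: "b3 \<in> {1.2858..1.2908}"
  using euler_mascheroni_bounds_3 ln_2_3_5_7_11_bounds(2) by (simp add: b3_def)

text \<open>On [n, n + 1] the integer parts are constant, so the approximant \<open>v\<close> is
  affine in y. The convex function y ln y lies above its tangent at t and below its chord, so it
  suffices to compare three affine functions at the two end points. \<open>l\<close>,
  \<open>a\<close>, \<open>b\<close> are rational bounds for the logarithms involved.\<close>

lemma log_err_le:
  fixes l t a b e y :: real
  assumes y: "real n \<le> y" "y \<le> real n + 1" and n: "n > 0" and t: "t > 0" "l \<le> ln t"
    and ab: "ln (real n) \<le> a" "ln (real n + 1) \<le> b"
  defines "v \<equiv> (\<lambda>x. x * (1.386 * harm n - 0.386 * harm (n div 3)) - 1.43 * real n + b3 * real (n div 3))"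
  assumes "v (real n) - e \<le> real n * (1 + l) - t" "v (real n + 1) - e \<le> (real n + 1) * (1 + l) - t"
    and "real n * a \<le> v (real n) + e" "(real n + 1) * b \<le> v (real n + 1) + e"
  shows "\<bar>log_err n y\<bar> \<le> e"
proof -
  define x where "x = y - real n"
  have x: "0 \<le> x" "x \<le> 1" "y = (1 - x) * real n + x * (real n + 1)"
    using y by (auto simp: x_def algebra_simps)
  have v: "v y = (1 - x) * v (real n) + x * v (real n + 1)"
    unfolding x(3) v_def by (simp add: field_simps)
  have err: "log_err n y = y * ln y - v y" by (simp add: log_err_def v_def)
  have "(1 - x) * (v (real n) - e) + x * (v (real n + 1) - e)
      \<le> (1 - x) * (real n * (1 + l) - t) + x * ((real n + 1) * (1 + l) - t)"
    using assms x by (intro add_mono mult_left_mono) auto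
  also have "\<dots> = y * (1 + l) - t" unfolding x(3) by (simp add: algebra_simps)
  also have "\<dots> \<le> y * ln y" using y n t by (intro xlnx_ge_tangent) auto
  finally have "v y - e \<le> y * ln y" unfolding v by (simp add: algebra_simps)
  moreover have "y * ln y \<le> (1 - x) * (real n * a) + x * ((real n + 1) * b)"
    using xlnx_le_chord[of "real n" y a b] y n ab by (simp add: x_def algebra_simps)
  moreover have "\<dots> \<le> (1 - x) * (v (real n) + e) + x * (v (real n + 1) + e)"
    using assms x by (intro add_mono mult_left_mono) auto
  moreover have "\<dots> = v y + e" unfolding v by (simp add: algebra_simps)
  ultimately show ?thesis unfolding err by linarith
qed

lemma ln_composites:
  "ln (4::real) = 2 * ln 2" "ln (6::real) = ln 2 + ln 3" "ln (8::real) = 3 * ln 2"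
  "ln (9::real) = 2 * ln 3" "ln (10::real) = ln 2 + ln 5" "ln (12::real) = 2 * ln 2 + ln 3"
  "ln (10/3::real) = ln 2 + ln 5 - ln 3" "ln (14/5::real) = ln 2 + ln 7 - ln 5"
  using ln_realpow[of 2 2] ln_mult[of 2 3] ln_realpow[of 2 3] ln_realpow[of 3 2] ln_mult[of 2 5]
    ln_mult[of "2^2" 3] ln_div[of 10 3] ln_mult[of 2 7] ln_div[of 14 5]
  by (simp_all add: ln_realpow)

text \<open>Here \<open>v\<close> has slope 1.386, and the tangent at t is parallel to it for ln t =
  0.386; 1.47 is close to that point and its logarithm is a combination of ln 2, ln 3, ln 5, ln 7.
  The coefficients nearly balance the error: about 0.044 at both ends and -0.041 in between.\<close>

lemma log_err_1:
  assumes "1 \<le> y" "y \<le> 2"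
  shows "\<bar>log_err 1 y\<bar> \<le> 0.045"
proof -
  have "ln (147/100::real) = ln (3 * 7\<^sup>2) - ln (2\<^sup>2 * 5\<^sup>2)" by (simp add: ln_div)
  also have "ln (3 * 7\<^sup>2 :: real) = ln 3 + 2 * ln 7" by (subst ln_mult) (simp_all only: ln_realpow, simp_all)
  also have "ln (2\<^sup>2 * 5\<^sup>2 :: real) = 2 * ln 2 + 2 * ln 5" by (subst ln_mult) (simp_all only: ln_realpow, simp_all)
  finally have "0.3852 \<le> ln (1.47::real)" using ln_2_3_5_7_11_bounds by simp
  then show ?thesis using assms ln_2_3_5_7_11_bounds(1)
    by (intro log_err_le[where t = "1.47" and l = "0.3852" and a = 0 and b = "0.69315"])
      (simp_all add: harm_expand)
qed

lemma log_err_2: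
  assumes "2 \<le> y" "y \<le> 3"
  shows "\<bar>log_err 2 y\<bar> \<le> 0.09"
  using assms ln_2_3_5_7_11_bounds ln_composites
  by (intro log_err_le[where t = "2.8" and l = "1.0295" and a = "0.69315" and b = "1.09862"])
    (simp_all add: harm_expand)

lemma log_err_small:
  assumes y: "real n \<le> y" "y \<le> real n + 1" and n: "n \<in> {3..11}"
  shows "\<bar>log_err n y\<bar> \<le> 0.2"
proof -
  note * = y b3_bounds ln_2_3_5_7_11_bounds ln_composites
  have "n \<in> {3,4,5,6,7,8,9,10,11}" using n by auto
  then show ?thesis
  proof (elim insertE emptyE)
    assume "n = 3" then show ?thesis using *
      by (intro log_err_le[where t = "10/3" and l = "1.2039" and a = "1.09862" and b = "1.3863"])
        (simp_all add: harm_expand)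
  next
    \<comment> \<open>From this cell on the tangent may touch at the left end point, since the
      second derivative 1/y of y ln y is small enough.\<close>
    assume "n = 4" then show ?thesis using *
      by (intro log_err_le[where t = "4" and l = "1.38628" and a = "1.3863" and b = "1.60945"])
        (simp_all add: harm_expand)
  next
    assume "n = 5" then show ?thesis using *
      by (intro log_err_le[where t = "5" and l = "1.60943" and a = "1.60945" and b = "1.79177"])
        (simp_all add: harm_expand)
  next
    assume "n = 6" then show ?thesis using *
      by (intro log_err_le[where t = "6" and l = "1.79175" and a = "1.79177" and b = "1.94592"])
        (simp_all add: harm_expand)
  next
    assume "n = 7" then show ?thesis using *
      by (intro log_err_le[where t = "7" and l = "1.9459" and a = "1.94592" and b = "2.07945"])
        (simp_all add: harm_expand)
  next
    assume "n = 8" then show ?thesis using *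
      by (intro log_err_le[where t = "8" and l = "2.07942" and a = "2.07945" and b = "2.19724"])
        (simp_all add: harm_expand)
  next
    assume "n = 9" then show ?thesis using *
      by (intro log_err_le[where t = "9" and l = "2.19722" and a = "2.19724" and b = "2.3026"])
        (simp_all add: harm_expand)
  next
    assume "n = 10" then show ?thesis using *
      by (intro log_err_le[where t = "10" and l = "2.30257" and a = "2.3026" and b = "2.39792"])
        (simp_all add: harm_expand)
  next
    assume "n = 11" then show ?thesis using *
      by (intro log_err_le[where t = "11" and l = "2.39789" and a = "2.39792" and b = "2.48492"])
        (simp_all add: harm_expand)
  qed
qed

text \<open>With n = 3 q + j, both harmonic numbers are expanded to second order. The growing terms
  cancel, because 1 - 1.386 + 0.386 = 0 and because of the choice of \<open>b3\<close>, leaving a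
  bounded remainder in which j = 0, 1, 2 is the only discrete parameter.\<close>

lemma log_err_large:
  assumes y: "real n \<le> y" "y \<le> real n + 1" and n: "n \<ge> 12"
  shows "\<bar>log_err n y\<bar> \<le> 0.2"
proof -
  define q j where "q = n div 3" and "j = n mod 3"
  define \<theta> where "\<theta> = y - real n"
  have nq: "n = 3 * q + j" and j: "j < 3" and q: "q \<ge> 4"
    using n by (auto simp: q_def j_def)
  have \<theta>: "0 \<le> \<theta>" "\<theta> \<le> 1" "y = real n + \<theta>" using y by (auto simp: \<theta>_def)
  have pos: "real n > 0" "real q > 0" "y > 0" using n q y by auto
  define \<mu> l where "\<mu> = ln y - ln (real n)" and "l = ln (real n) - ln (3 * real q)"
  define \<rho> where "\<rho> m = ln (real m) + euler_mascheroni + 1 / (2 * real m) - harm m" for m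
  \<comment> \<open>\<open>b3\<close> equals 3 (1.43 - \<kappa>), so \<kappa> collects the constants
    of the two harmonic expansions.\<close>
  define \<kappa> :: real where "\<kappa> = euler_mascheroni + 0.386 * ln 3"
  have \<kappa>: "\<kappa> \<in> {0.9997..1.0014}"
    using euler_mascheroni_bounds_3 ln_2_3_5_7_11_bounds(2) by (simp add: \<kappa>_def)
  have \<rho>: "0 \<le> \<rho> n" "\<rho> n \<le> 1 / (12 * real n ^ 2)" "0 \<le> \<rho> q" "\<rho> q \<le> 1 / (12 * real q ^ 2)"
    using harm_approx[of n] harm_approx[of q] n q by (auto simp: \<rho>_def)
  have lnq: "ln (3 * real q) = ln 3 + ln (real q)" using pos by (simp add: ln_mult_pos)
  \<comment> \<open>The coefficients 0.693 and 0.193 are halves of 1.386 and 0.386; they come from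
    the terms 1 / (2 n) and 1 / (2 q) of the harmonic numbers.\<close>
  have main: "log_err n y = y * \<mu> - 0.386 * (y * l) - 0.693 * (y / real n) + 0.193 * (y / real q)
      + 1.386 * (y * \<rho> n) - 0.386 * (y * \<rho> q) + (1.43 - \<kappa>) * real j - \<kappa> * \<theta>"
  proof -
    define i k where "i = 1 / real n" and "k = 1 / real q"
    have "harm n = ln (real n) + euler_mascheroni + i / 2 - \<rho> n"
      "harm q = ln (real n) - l - ln 3 + euler_mascheroni + k / 2 - \<rho> q"
      using lnq by (simp_all add: \<rho>_def l_def i_def k_def)
    moreover have "ln y = ln (real n) + \<mu>" by (simp add: \<mu>_def)
    moreover have "b3 * real q = 3 * 1.43 * real q - \<kappa> * (y - \<theta> - real j)"
      using \<theta> nq by (simp add: b3_def \<kappa>_def algebra_simps)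
    moreover have "1.43 * real n = 3 * 1.43 * real q + 1.43 * real j" using nq by simp
    moreover have "y / real n = y * i" "y / real q = y * k" by (simp_all add: i_def k_def)
    ultimately have "log_err n y = y * (ln (real n) + \<mu>) - y * (1.386 * (ln (real n) + euler_mascheroni + i / 2 - \<rho> n)
        - 0.386 * (ln (real n) - l - ln 3 + euler_mascheroni + k / 2 - \<rho> q))
        + (3 * 1.43 * real q + 1.43 * real j) - (3 * 1.43 * real q - \<kappa> * (y - \<theta> - real j))"
      unfolding log_err_def q_def[symmetric] by (simp only:)
    also have "\<dots> = y * \<mu> - 0.386 * (y * l) - 0.693 * (y * i) + 0.193 * (y * k)
      + 1.386 * (y * \<rho> n) - 0.386 * (y * \<rho> q) + (1.43 - \<kappa>) * real j - \<kappa> * \<theta>"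
      by (simp add: \<kappa>_def field_simps)
    finally show ?thesis by (simp add: i_def k_def)
  qed
  define a u w where "a = \<theta> / real n" and "u = 1 / real q" and "w = \<theta> / real q"
  have a: "0 \<le> a" "a \<le> 1 / 12" using \<theta> n by (auto simp: a_def divide_simps)
  have u: "0 \<le> u" "u \<le> 1 / 4" using q by (auto simp: u_def divide_simps)
  have w: "0 \<le> w" "w \<le> 1 / 4" using \<theta> q by (auto simp: w_def divide_simps)
  have yn: "y / real n = 1 + a" using \<theta> pos by (simp add: a_def field_simps)
  have yq: "y / real q = 3 + real j * u + w" using \<theta> pos nq by (simp add: u_def w_def field_simps)
  have aw: "a \<le> w / 3" using \<theta> pos nq by (simp add: a_def w_def frac_le)
  have \<mu>u: "y * \<mu> \<le> \<theta> + a"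
  proof -
    have "\<mu> \<le> y / real n - 1" using ln_le_minus_one[of "y / real n"] pos by (simp add: \<mu>_def ln_div)
    then have "y * \<mu> \<le> y * a" using yn pos by simp
    also have "\<dots> = \<theta> + \<theta> * a" using \<theta> pos by (simp add: a_def field_simps)
    also have "\<dots> \<le> \<theta> + a" using \<theta> a by (simp add: mult_left_le_one_le)
    finally show ?thesis .
  qed
  have \<mu>l: "\<theta> \<le> y * \<mu>"
  proof -
    have "- \<mu> \<le> real n / y - 1" using ln_le_minus_one[of "real n / y"] pos by (simp add: \<mu>_def ln_div)
    then have "y * - \<mu> \<le> y * (real n / y - 1)" using pos by (intro mult_left_mono) auto
    also have "\<dots> = - \<theta>" using \<theta> pos by (simp add: field_simps)
    finally show ?thesis by simp
  qed
  have lu: "y * l \<le> real j + real j * (real j * u + w) / 3"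
  proof -
    have "l \<le> real n / (3 * real q) - 1"
      using ln_le_minus_one[of "real n / (3 * real q)"] pos by (simp add: l_def ln_div)
    also have "\<dots> = real j / (3 * real q)" using pos nq by (simp add: field_simps)
    finally have "y * l \<le> y * (real j / (3 * real q))" using pos by (intro mult_left_mono) auto
    also have "\<dots> = real j / 3 * (y / real q)" by simp
    finally show ?thesis unfolding yq by (simp add: algebra_simps add_divide_distrib)
  qed
  have ll: "real j * (1 + a) \<le> y * l"
  proof -
    have "- l \<le> 3 * real q / real n - 1"
      using ln_le_minus_one[of "3 * real q / real n"] pos by (simp add: l_def ln_div)
    also have "\<dots> = - (real j / real n)" using pos nq by (simp add: field_simps)
    finally have "y * (real j / real n) \<le> y * l" using pos by (intro mult_left_mono) auto
    also have "y * (real j / real n) = real j * (1 + a)" unfolding yn[symmetric] by simp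
    finally show ?thesis .
  qed
  have \<rho>n: "0 \<le> y * \<rho> n" "y * \<rho> n \<le> 0.0076"
  proof -
    have "y * \<rho> n \<le> y * (1 / (12 * real n ^ 2))" using \<rho> pos by (intro mult_left_mono) auto
    also have "\<dots> = (1 + a) / (12 * real n)" unfolding yn[symmetric] by (simp add: power2_eq_square)
    also have "\<dots> \<le> (1 + 1/12) / (12 * 12)" using a n by (intro frac_le) auto
    finally show "y * \<rho> n \<le> 0.0076" by simp
    show "0 \<le> y * \<rho> n" using \<rho> pos by simp
  qed
  have \<rho>q: "0 \<le> y * \<rho> q" "y * \<rho> q \<le> 0.0785"
  proof -
    have "y * \<rho> q \<le> y * (1 / (12 * real q ^ 2))" using \<rho> pos by (intro mult_left_mono) auto
    also have "\<dots> = (3 + real j * u + w) / (12 * real q)" unfolding yq[symmetric] by (simp add: power2_eq_square)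
    also have "\<dots> \<le> (3 + 2 * (1/4) + 1/4) / (12 * 4)" using u w q j by (intro frac_le add_mono mult_mono) auto
    finally show "y * \<rho> q \<le> 0.0785" by simp
    show "0 \<le> y * \<rho> q" using \<rho> pos by simp
  qed
  have \<kappa>\<theta>: "0.9997 * \<theta> \<le> \<kappa> * \<theta>" "\<kappa> * \<theta> \<le> 1.0014 * \<theta>"
    using \<kappa> \<theta> mult_right_mono[of "0.9997" \<kappa> \<theta>] mult_right_mono[of \<kappa> "1.0014" \<theta>] by simp_all
  \<comment> \<open>Naming the products makes them atoms: once j is a numeral, every remaining
    inequality is linear in them and in a, u, w, \<theta>, \<kappa>.\<close>
  define p1 p2 p3 p4 p5 where p_def: "p1 = y * \<mu>" "p2 = y * l" "p3 = y * \<rho> n" "p4 = y * \<rho> q" "p5 = \<kappa> * \<theta>"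
  have "j \<in> {0, 1, 2}" using j by auto
  then show ?thesis
  proof (elim insertE emptyE)
    assume "j = 0"
    then have *: "real j = 0" by simp
    show ?thesis using \<kappa>\<theta> \<rho>n \<rho>q ll lu \<mu>l \<mu>u aw a u w \<theta>(1,2) \<kappa>
      unfolding main yn yq * p_def[symmetric] by (intro abs_leI) (simp_all add: field_simps)
  next
    assume "j = 1"
    then have *: "real j = 1" by simp
    show ?thesis using \<kappa>\<theta> \<rho>n \<rho>q ll lu \<mu>l \<mu>u aw a u w \<theta>(1,2) \<kappa>
      unfolding main yn yq * p_def[symmetric] by (intro abs_leI) (simp_all add: field_simps)
  next
    assume "j = 2"
    then have *: "real j = 2" by simp
    show ?thesis using \<kappa>\<theta> \<rho>n \<rho>q ll lu \<mu>l \<mu>u aw a u w \<theta>(1,2) \<kappa>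
      unfolding main yn yq * p_def[symmetric] by (intro abs_leI) (simp_all add: field_simps)
  qed
qed

section \<open>The logarithmic Moebius sum\<close>

text \<open>For m > N the inner sum is empty because \<open>N div m = 0\<close>. This lets the sums
  for N and for \<open>N div 3\<close> be taken over the same range of m.\<close>

lemma sum_moebius_dilate_le:
  fixes f :: "nat \<Rightarrow> real"
  assumes "1 \<le> N" "N \<le> M"
  shows "(\<Sum>m=1..M. moebius_mu m * (\<Sum>n=1..N div m. f (m * n))) = f 1"
proof -
  have "(\<Sum>m=1..M. moebius_mu m * (\<Sum>n=1..N div m. f (m * n)))
      = (\<Sum>m=1..N. moebius_mu m * (\<Sum>n=1..N div m. f (m * n)))"
    using assms by (intro sum.mono_neutral_right) auto
  then show ?thesis using sum_moebius_dilate assms by simp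
qed

text \<open>Multiples of 4 are not squarefree, so skipping them improves the trivial bound for \<mu>
  by a factor 3/4. Without this the error would have size about 0.104 x, too large for
  1.082.\<close>

lemma card_not_4_dvd: "real (card {m\<in>{1..K}. \<not> 4 dvd m}) \<le> 3 / 4 * real K + 3 / 4"
proof -
  have "card {m\<in>{1..K}. \<not> 4 dvd m} + K div 4 = K"
  proof (induction K)
    case (Suc K)
    have "{m\<in>{1..Suc K}. \<not> 4 dvd m} = (if 4 dvd Suc K then {m\<in>{1..K}. \<not> 4 dvd m} else insert (Suc K) {m\<in>{1..K}. \<not> 4 dvd m})"
      by (auto simp: le_Suc_eq)
    with Suc show ?case by (auto simp: div_Suc dvd_eq_mod_eq_0)
  qed simp
  moreover have "K \<le> 4 * (K div 4) + 3" by presburger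
  ultimately have "4 * card {m\<in>{1..K}. \<not> 4 dvd m} \<le> 3 * K + 3" by linarith
  then have "real (4 * card {m\<in>{1..K}. \<not> 4 dvd m}) \<le> real (3 * K + 3)" by (rule of_nat_mono)
  then show ?thesis by simp
qed

lemma moebius_mu_4_dvd: "4 dvd m \<Longrightarrow> moebius_mu m = 0"
  using not_squarefreeI[of 2 m] by (auto intro!: moebius_mu_not_squarefree)

text \<open>About half of all m \<le> N have \<open>N div m = 1\<close>, so the first cells deserve
  the finer bounds 0.045 and 0.09 before 0.2 takes over. As increments they turn the sum over m into
  counts of m up to N, N/2 and N/3.\<close>

lemma abs_log_err_le:
  assumes "n \<ge> 1" "real n \<le> y" "y \<le> real n + 1"
  shows "\<bar>log_err n y\<bar> \<le> 0.045 + (if 2 \<le> n then 0.045 else 0) + (if 3 \<le> n then 0.11 else 0)"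
proof -
  consider "n = 1" | "n = 2" | "n \<in> {3..11}" | "n \<ge> 12" using assms by fastforce
  then show ?thesis
    using log_err_1[of y] log_err_2[of y] log_err_small[of n y] log_err_large[of n y] assms
    by cases auto
qed

lemma sum_moebius_log_err:
  assumes x: "x \<ge> 1"
  defines "N \<equiv> nat \<lfloor>x\<rfloor>"
  shows "\<bar>\<Sum>m=1..N. moebius_mu m * log_err (N div m) (x / real m)\<bar> \<le> 0.0782 * x + 0.15"
proof -
  have N: "real N \<le> x" "x < real N + 1" "N \<ge> 1" using x by (auto simp: N_def le_nat_floor)
  let ?S = "{m\<in>{1..N}. \<not> 4 dvd m}"
  have "\<bar>\<Sum>m=1..N. moebius_mu m * log_err (N div m) (x / real m)\<bar>
      = \<bar>\<Sum>m\<in>?S. moebius_mu m * log_err (N div m) (x / real m)\<bar>"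
    by (intro arg_cong[where f = abs] sum.mono_neutral_right) (auto simp: moebius_mu_4_dvd)
  also have "\<dots> \<le> (\<Sum>m\<in>?S. 0.045 + (if 2 \<le> N div m then 0.045 else 0) + (if 3 \<le> N div m then 0.11 else 0))"
  proof (rule sum_abs[THEN order_trans], rule sum_mono)
    fix m assume m: "m \<in> ?S"
    have "real (N div m * m) \<le> real N" by (intro of_nat_mono) simp
    then have 1: "real (N div m) \<le> x / real m" using m N by (simp add: field_simps)
    have "N < (N div m + 1) * m" using m by (simp add: dividend_less_div_times)
    then have "real (N + 1) \<le> real ((N div m + 1) * m)" by (intro of_nat_mono) linarith
    then have 2: "x / real m \<le> real (N div m) + 1" using m N by (simp add: field_simps)
    have "\<bar>moebius_mu m * log_err (N div m) (x / real m)\<bar> \<le> 1 * \<bar>log_err (N div m) (x / real m)\<bar>"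
      unfolding abs_mult by (intro mult_right_mono abs_moebius_mu_le_1) simp
    also have "\<dots> \<le> 0.045 + (if 2 \<le> N div m then 0.045 else 0) + (if 3 \<le> N div m then 0.11 else 0)"
      using abs_log_err_le[OF _ 1 2] m by (simp add: Suc_le_eq div_greater_zero_iff)
    finally show "\<bar>moebius_mu m * log_err (N div m) (x / real m)\<bar>
      \<le> 0.045 + (if 2 \<le> N div m then 0.045 else 0) + (if 3 \<le> N div m then 0.11 else 0)" .
  qed
  also have "\<dots> = 0.045 * card ?S + 0.045 * card {m\<in>{1..N div 2}. \<not> 4 dvd m}
      + 0.11 * card {m\<in>{1..N div 3}. \<not> 4 dvd m}"
  proof -
    have *: "(\<Sum>m\<in>?S. if k \<le> N div m then c else 0) = c * card {m\<in>{1..N div k}. \<not> 4 dvd m}"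
      if "k > 0" for k and c :: real
    proof -
      have "{m\<in>?S. k \<le> N div m} = {m\<in>{1..N div k}. \<not> 4 dvd m}"
        using that le_trans[OF _ div_le_dividend[of N k]]
        by (auto simp: less_eq_div_iff_mult_less_eq mult.commute)
      then show ?thesis by (simp flip: sum.inter_filter)
    qed
    show ?thesis by (simp only: sum.distrib *) simp
  qed
  also have "\<dots> \<le> 0.045 * (3/4 * real N + 3/4) + 0.045 * (3/4 * real (N div 2) + 3/4)
      + 0.11 * (3/4 * real (N div 3) + 3/4)"
    by (intro add_mono mult_left_mono card_not_4_dvd) auto
  \<comment> \<open>The slope is 3/4 (0.045 + 0.045/2 + 0.11/3) = 0.078125 and the constant is 3/4 *
    0.2.\<close>
  also have "\<dots> \<le> 0.0782 * x + 0.15"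
    using x N of_nat_div_le_of_nat[where 'a = real, of N 2] of_nat_div_le_of_nat[where 'a = real, of N 3] by (simp add: field_simps)
  finally show ?thesis .
qed

text \<open>\<open>x \<ge> 3\<close> ensures \<open>N div 3 \<ge> 1\<close>, so each of the four
  Moebius sums equals 1. The harmonic ones contribute 1.386 - 0.386 = 1, the integer parts (b3 -
  1.43) / x.\<close>

lemma sum_moebius_log_expansion:
  assumes x: "x \<ge> 3"
  defines "N \<equiv> nat \<lfloor>x\<rfloor>"
  shows "(\<Sum>m=1..N. moebius_mu m / real m * ln (x / real m))
    = 1 + (b3 - 1.43) / x + (\<Sum>m=1..N. moebius_mu m * log_err (N div m) (x / real m)) / x"
proof -
  have N: "3 \<le> N" using x by (simp add: N_def le_nat_floor)
  define h where "h K m = (\<Sum>n=1..K div m. 1 / real (m * n))" for K m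
  define c :: "nat \<Rightarrow> nat \<Rightarrow> real" where "c K m = (\<Sum>n=1..K div m. 1)" for K m
  have h: "(\<Sum>m=1..N. moebius_mu m * h K m) = 1" if "1 \<le> K" "K \<le> N" for K
    unfolding h_def using sum_moebius_dilate_le[OF that, of "\<lambda>k. 1 / real k"] by simp
  have c: "(\<Sum>m=1..N. moebius_mu m * c K m) = 1" if "1 \<le> K" "K \<le> N" for K
    unfolding c_def using sum_moebius_dilate_le[OF that, of "\<lambda>k. 1"] by simp
  have "moebius_mu m / real m * ln (x / real m)
      = moebius_mu m * log_err (N div m) (x / real m) / x
        + (1.386 * (moebius_mu m * h N m) - 0.386 * (moebius_mu m * h (N div 3) m))
        + (b3 * (moebius_mu m * c (N div 3) m) - 1.43 * (moebius_mu m * c N m)) / x"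
    if m: "m \<in> {1..N}" for m
  proof -
    \<comment> \<open>Interchanging the two divisions is what turns the integer part of (x/m)/3 into
      a dilation sum with bound \<open>N div 3\<close>.\<close>
    have div: "N div m div 3 = N div 3 div m" by (simp flip: div_mult2_eq add: mult.commute)
    have hm: "h K m = harm (K div m) / real m" for K
      by (simp add: h_def harm_def sum_distrib_left sum_distrib_right divide_inverse mult.commute)
    have cm: "c K m = real (K div m)" for K
      by (simp add: c_def)
    show ?thesis unfolding log_err_def hm cm div using m x by (simp add: field_simps)
  qed
  then have "(\<Sum>m=1..N. moebius_mu m / real m * ln (x / real m))
      = (\<Sum>m=1..N. moebius_mu m * log_err (N div m) (x / real m) / x
        + (1.386 * (moebius_mu m * h N m) - 0.386 * (moebius_mu m * h (N div 3) m))
        + (b3 * (moebius_mu m * c (N div 3) m) - 1.43 * (moebius_mu m * c N m)) / x)"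
    by (intro sum.cong refl)
  also have "\<dots> = (\<Sum>m=1..N. moebius_mu m * log_err (N div m) (x / real m)) / x
        + (1.386 * (\<Sum>m=1..N. moebius_mu m * h N m) - 0.386 * (\<Sum>m=1..N. moebius_mu m * h (N div 3) m))
        + (b3 * (\<Sum>m=1..N. moebius_mu m * c (N div 3) m) - 1.43 * (\<Sum>m=1..N. moebius_mu m * c N m)) / x"
    by (simp only: sum.distrib sum_subtractf sum_distrib_left[symmetric] sum_divide_distrib[symmetric])
  finally show ?thesis using N h[of N] c[of N] h[of "N div 3"] c[of "N div 3"] by simp
qed

lemma sum_moebius_log_bounds:
  assumes x: "x \<ge> 1"
  shows "(\<Sum>m=1..nat \<lfloor>x\<rfloor>. moebius_mu m / real m * ln (x / real m)) \<in> {0..1.082}"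
proof -
  define N where "N = nat \<lfloor>x\<rfloor>"
  have N: "real N \<le> x" "x < real N + 1" "N \<ge> 1" using x by (auto simp: N_def le_nat_floor)
  have mu2: "moebius_mu 2 = -1" using moebius_mu_prime_mult[of 2 1] by simp
  consider "N = 1" | "N = 2" | "x \<ge> 3" using N by linarith
  then have "(\<Sum>m=1..N. moebius_mu m / real m * ln (x / real m)) \<in> {0..1.082}"
  proof cases
    case 1
    have "ln x \<le> ln 2" using 1 N x by simp
    then have "ln x \<le> 0.7" using ln_2_3_5_7_11_bounds(1) by simp
    then show ?thesis using x unfolding 1 by simp
  next
    case 2
    have "ln (x / 2) = ln x - ln 2" using x by (simp add: ln_div)
    moreover have "ln x \<le> ln 3" "ln 2 \<le> ln x" using 2 N x by simp_all
    then have "ln x \<in> {0.69..1.1}" using ln_2_3_5_7_11_bounds(1,2) by simp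
    ultimately show ?thesis
      using ln_2_3_5_7_11_bounds(1) mu2
      unfolding 2 by (simp add: numeral_2_eq_2 field_simps)
  next
    case 3
    define E where "E = (\<Sum>m=1..N. moebius_mu m * log_err (N div m) (x / real m)) / x"
    define i t where "i = 1 / x" and "t = (b3 - 1.43) / x"
    have i: "0 \<le> i" "i \<le> 1 / 3" using 3 by (auto simp: i_def field_simps)
    have "\<bar>E\<bar> \<le> (0.0782 * x + 0.15) / x"
      using sum_moebius_log_err[OF x] 3 by (simp add: E_def N_def abs_divide divide_right_mono)
    also have "\<dots> = 0.0782 + 0.15 * i" using 3 by (simp add: i_def field_simps)
    finally have E: "\<bar>E\<bar> \<le> 0.0782 + 0.15 * i" .
    have "- 0.1442 * i \<le> (b3 - 1.43) * i"
      by (rule mult_right_mono) (use b3_bounds i in simp_all)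
    moreover have "(b3 - 1.43) * i \<le> - 0.1392 * i"
      by (rule mult_right_mono) (use b3_bounds i in simp_all)
    moreover have "(b3 - 1.43) * i = t" by (simp add: i_def t_def)
    \<comment> \<open>The upper bound is largest at x = 3, namely 1 + 0.0782 + (0.15 - 0.1392) / 3 =
      1.0818.\<close>
    ultimately have "1 + t + E \<in> {0..1.082}"
      using E i by (simp add: abs_le_iff)
    then show ?thesis
      using sum_moebius_log_expansion[OF 3] by (simp add: E_def N_def t_def)
  qed
  then show ?thesis by (simp add: N_def)
qed

section \<open>Twisting by a power and imposing coprimality\<close>

lemma log_plus_nonneg [simp]: "0 \<le> log_plus t"
  by (simp add: log_plus_def)

lemma log_plus_eq_0: "0 < t \<Longrightarrow> t \<le> 1 \<Longrightarrow> log_plus t = 0"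
  by (simp add: log_plus_def max_def)

lemma log_plus_eq_ln: "1 \<le> t \<Longrightarrow> log_plus t = ln t"
  by (simp add: log_plus_def)

text \<open>Taylor's formula with integral remainder for \<phi>(u) = exp(-\<epsilon> u) (ln x - u),
  expanded at u = ln x. The kernel is \<phi>''(ln t) / t, and the coefficient x^(-\<epsilon>) of the
  linear term is -\<phi>'(ln x).\<close>

lemma has_integral_log_kernel:
  fixes \<epsilon> x m :: real
  assumes m: "1 \<le> m" "m \<le> x"
  shows "((\<lambda>t. log_plus (t / m) * ((2 * \<epsilon> + \<epsilon>\<^sup>2 * ln (x / t)) * t powr (- \<epsilon> - 1)))
    has_integral m powr - \<epsilon> * ln (x / m) - x powr - \<epsilon> * ln (x / m)) {1..x}"
proof -
  let ?F = "\<lambda>t. - (ln t - ln m) * t powr - \<epsilon> * (1 + \<epsilon> * (ln x - ln t)) - t powr - \<epsilon> * (ln x - ln t)"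
  let ?f = "\<lambda>t. log_plus (t / m) * ((2 * \<epsilon> + \<epsilon>\<^sup>2 * ln (x / t)) * t powr (- \<epsilon> - 1))"
  have "(?f has_integral 0) {1..m}"
    by (rule has_integral_is_0) (use m in \<open>auto simp: log_plus_eq_0\<close>)
  moreover have "(?f has_integral ?F x - ?F m) {m..x}"
  proof (rule fundamental_theorem_of_calculus)
    fix t assume t: "t \<in> {m..x}"
    then have t0: "t > 0" "m > 0" "x > 0" using m by auto
    have "(?F has_real_derivative ?f t) (at t)"
    proof -
      have p: "t powr (- \<epsilon> - 1) = t powr - \<epsilon> / t" using t0 by (simp add: powr_diff)
      have l: "log_plus (t / m) = ln t - ln m" "ln (x / t) = ln x - ln t"
        using t t0 by (simp_all add: log_plus_eq_ln ln_div)
      show ?thesis unfolding l p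
        using t0 by (auto intro!: derivative_eq_intros simp: p) (simp add: field_simps power2_eq_square)
    qed
    then show "(?F has_vector_derivative ?f t) (at t within {m..x})"
      using has_real_derivative_iff_has_vector_derivative has_vector_derivative_at_within by blast
  qed (use m in auto)
  ultimately have "(?f has_integral 0 + (?F x - ?F m)) {1..x}"
    using m by (intro has_integral_combine[of 1 m x]) auto
  moreover have "0 + (?F x - ?F m) = m powr - \<epsilon> * ln (x / m) - x powr - \<epsilon> * ln (x / m)"
    using m by (simp add: ln_div algebra_simps)
  ultimately show ?thesis by simp
qed

text \<open>Together with the point mass x^(-\<epsilon>) at t = x, the kernel has total mass 1 +
  \<epsilon> ln x. This is the origin of that factor in all later bounds.\<close>

lemma has_integral_kernel:
  fixes \<epsilon> x :: real
  assumes x: "1 \<le> x"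
  shows "((\<lambda>t. (2 * \<epsilon> + \<epsilon>\<^sup>2 * ln (x / t)) * t powr (- \<epsilon> - 1))
    has_integral 1 + \<epsilon> * ln x - x powr - \<epsilon>) {1..x}"
proof -
  let ?F = "\<lambda>t. - (t powr - \<epsilon>) * (1 + \<epsilon> * (ln x - ln t))"
  let ?f = "\<lambda>t. (2 * \<epsilon> + \<epsilon>\<^sup>2 * ln (x / t)) * t powr (- \<epsilon> - 1)"
  have "(?f has_integral ?F x - ?F 1) {1..x}"
  proof (rule fundamental_theorem_of_calculus)
    fix t assume t: "t \<in> {1..x}"
    then have t0: "t > 0" "x > 0" using x by auto
    have "(?F has_real_derivative ?f t) (at t)"
    proof -
      have p: "t powr (- \<epsilon> - 1) = t powr - \<epsilon> / t" using t0 by (simp add: powr_diff)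
      have l: "ln (x / t) = ln x - ln t"
        using t t0 by (simp_all add: ln_div)
      show ?thesis unfolding l p
        using t0 by (auto intro!: derivative_eq_intros simp: p) (simp add: field_simps power2_eq_square)
    qed
    then show "(?F has_vector_derivative ?f t) (at t within {1..x})"
      using has_real_derivative_iff_has_vector_derivative has_vector_derivative_at_within by blast
  qed (use x in auto)
  then show ?thesis by (simp add: algebra_simps)
qed

text \<open>With \<open>log_plus\<close> in place of \<open>ln\<close>, one range of m serves every
  argument below M + 1, so that sum and integral over the argument can be interchanged.\<close>

lemma sum_moebius_log_plus_bounds:
  assumes x: "1 \<le> x" "x < real M + 1"
  shows "(\<Sum>m=1..M. moebius_mu m / real m * log_plus (x / real m)) \<in> {0..1.082}"
proof -
  have "real (nat \<lfloor>x\<rfloor>) < real (M + 1)" using x by linarith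
  then have N: "nat \<lfloor>x\<rfloor> \<le> M" unfolding of_nat_less_iff by linarith
  have "log_plus (x / real m) = 0" if "m \<in> {1..M} - {1..nat \<lfloor>x\<rfloor>}" for m
  proof -
    have "nat \<lfloor>x\<rfloor> < m" "m > 0" using that by auto
    then have "x / real m \<le> 1" "0 < x / real m" using x by (auto simp: field_simps) linarith
    then show ?thesis by (simp add: log_plus_eq_0)
  qed
  then have "(\<Sum>m=1..M. moebius_mu m / real m * log_plus (x / real m))
      = (\<Sum>m=1..nat \<lfloor>x\<rfloor>. moebius_mu m / real m * log_plus (x / real m))"
    using N by (intro sum.mono_neutral_right) auto
  also have "\<dots> = (\<Sum>m=1..nat \<lfloor>x\<rfloor>. moebius_mu m / real m * ln (x / real m))"
  proof (intro sum.cong refl)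
    fix m assume "m \<in> {1..nat \<lfloor>x\<rfloor>}"
    then have "1 \<le> x / real m" using x by (auto simp: field_simps) linarith
    then show "moebius_mu m / real m * log_plus (x / real m) = moebius_mu m / real m * ln (x / real m)"
      by (simp add: log_plus_eq_ln)
  qed
  finally show ?thesis using sum_moebius_log_bounds[OF x(1)] by simp
qed

text \<open>
  The weight \<open>exp (- \<epsilon> u) (ln x - u)\<close> is convex on \<open>[0, ln x]\<close>, hence a mixture with positive
  coefficients of the weights \<open>(ln t - u)\<^sup>+\<close>; this transfers bounds from \<open>\<epsilon> = 0\<close>.
\<close>

lemma sum_moebius_powr_log_plus_bounds:
  fixes \<epsilon> x :: real
  assumes \<epsilon>: "\<epsilon> > 0" and x: "1 \<le> x" "x < real M + 1"
  shows "(\<Sum>m=1..M. moebius_mu m * real m powr - (1 + \<epsilon>) * log_plus (x / real m))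
     \<in> {0..1.082 * (1 + \<epsilon> * ln x)}"
proof -
  let ?k = "\<lambda>t. (2 * \<epsilon> + \<epsilon>\<^sup>2 * ln (x / t)) * t powr (- \<epsilon> - 1)"
  let ?G = "\<lambda>t. \<Sum>m=1..M. moebius_mu m / real m * log_plus (t / real m)"
  define S where "S = (\<Sum>m=1..M. moebius_mu m * real m powr - (1 + \<epsilon>) * log_plus (x / real m))"
  have int: "((\<lambda>t. log_plus (t / real m) * ?k t) has_integral
      real m powr - \<epsilon> * log_plus (x / real m) - x powr - \<epsilon> * log_plus (x / real m)) {1..x}"
    if m: "m \<in> {1..M}" for m
  proof (cases "real m \<le> x")
    case True
    then show ?thesis using has_integral_log_kernel[of "real m" x \<epsilon>] m by (simp add: log_plus_eq_ln)
  next
    case False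
    then have *: "log_plus (t / real m) = 0" if "t \<in> {1..x}" for t
      using that m by (intro log_plus_eq_0) auto
    then have "log_plus (x / real m) = 0" using x by simp
    then show ?thesis using * by (auto intro!: has_integral_is_0)
  qed
  have "((\<lambda>t. \<Sum>m=1..M. moebius_mu m / real m * (log_plus (t / real m) * ?k t)) has_integral
    (\<Sum>m=1..M. moebius_mu m / real m * (real m powr - \<epsilon> * log_plus (x / real m) - x powr - \<epsilon> * log_plus (x / real m)))) {1..x}"
    by (intro has_integral_sum has_integral_mult_right int) auto
  moreover have "(\<Sum>m=1..M. moebius_mu m / real m * (log_plus (t / real m) * ?k t)) = ?G t * ?k t" for t
    by (simp add: sum_distrib_right mult.assoc)
  moreover have "(\<Sum>m=1..M. moebius_mu m / real m * (real m powr - \<epsilon> * log_plus (x / real m) - x powr - \<epsilon> * log_plus (x / real m)))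
     = S - x powr - \<epsilon> * ?G x"
    unfolding S_def sum_distrib_left sum_subtractf[symmetric]
    by (intro sum.cong refl) (simp add: powr_diff powr_minus field_simps)
  ultimately have I: "((\<lambda>t. ?G t * ?k t) has_integral S - x powr - \<epsilon> * ?G x) {1..x}" by simp
  have k: "0 \<le> ?k t" if "t \<in> {1..x}" for t using that \<epsilon> by simp
  have G: "?G t \<in> {0..1.082}" if "t \<in> {1..x}" for t
    using that x by (intro sum_moebius_log_plus_bounds) auto
  have "0 \<le> S - x powr - \<epsilon> * ?G x"
    using I by (rule has_integral_nonneg) (use G k in fastforce)
  moreover have "S - x powr - \<epsilon> * ?G x \<le> 1.082 * (1 + \<epsilon> * ln x - x powr - \<epsilon>)"
  proof (rule has_integral_le[OF I has_integral_mult_right[OF has_integral_kernel[OF x(1)]]])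
    fix t assume t: "t \<in> {1..x}"
    show "?G t * ?k t \<le> 1.082 * ?k t" using G[OF t] by (intro mult_right_mono k[OF t]) auto
  qed
  moreover have "0 \<le> x powr - \<epsilon> * ?G x" "x powr - \<epsilon> * ?G x \<le> x powr - \<epsilon> * 1.082"
    using G[of x] x by (auto intro!: mult_left_mono)
  ultimately have "S \<in> {0..1.082 * (1 + \<epsilon> * ln x)}"
    by (simp add: algebra_simps)
  then show ?thesis by (simp add: S_def)
qed

section \<open>Removing primes one at a time\<close>

definition coprime_log_sum :: "nat set \<Rightarrow> nat \<Rightarrow> real \<Rightarrow> real \<Rightarrow> real" where
  "coprime_log_sum P M s x =
     (\<Sum>m | m \<in> {1..M} \<and> (\<forall>p\<in>P. \<not> p dvd m). moebius_mu m * real m powr - s * log_plus (x / real m))"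

lemma coprime_log_sum_eq_0:
  assumes "0 < x" "x < 1"
  shows "coprime_log_sum P M s x = 0"
  unfolding coprime_log_sum_def
proof (intro sum.neutral ballI)
  fix m assume "m \<in> {m \<in> {1..M}. \<forall>p\<in>P. \<not> p dvd m}"
  then have "log_plus (x / real m) = 0" using assms by (intro log_plus_eq_0) auto
  then show "moebius_mu m * real m powr - s * log_plus (x / real m) = 0" by simp
qed

text \<open>Among the m allowed by \<open>P\<close>, those divisible by p^2 drop out and those of
  the form p * k with p not dividing k give -p^(-s) times the sum without p at x / p.\<close>

lemma coprime_log_sum_insert:
  assumes p: "prime p" "p \<notin> P" and P: "\<And>q. q \<in> P \<Longrightarrow> prime q" and x: "0 < x" "x < real M + 1"
  shows "coprime_log_sum (insert p P) M s x
    = coprime_log_sum P M s x + real p powr - s * coprime_log_sum (insert p P) M s (x / real p)"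
proof -
  let ?f = "\<lambda>m. moebius_mu m * real m powr - s * log_plus (x / real m)"
  let ?A = "{m. m \<in> {1..M} \<and> (\<forall>q\<in>P. \<not> q dvd m)}"
  let ?B = "{m. m \<in> {1..M} \<and> (\<forall>q\<in>insert p P. \<not> q dvd m)}"
  let ?C = "{m\<in>?B. p * m \<le> M}"
  have p0: "p > 0" using p prime_gt_0_nat by blast
  have qp: "\<not> q dvd p" if "q \<in> P" for q
    using primes_dvd_imp_eq[of q p] P p that by auto
  have "sum ?f ?A = sum ?f ?B + sum ?f ((*) p ` ?C)"
  proof -
    have "sum ?f ?A = sum ?f (?B \<union> (*) p ` ?C)"
    proof (rule sum.mono_neutral_right)
      show "?B \<union> (*) p ` ?C \<subseteq> ?A"
        using p P p0 qp by (auto simp: prime_dvd_mult_iff Suc_le_eq)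
      show "\<forall>m\<in>?A - (?B \<union> (*) p ` ?C). ?f m = 0"
      proof
        fix m assume m: "m \<in> ?A - (?B \<union> (*) p ` ?C)"
        then obtain k where k: "m = p * k" by auto
        have "p dvd k"
        proof (rule ccontr)
          assume "\<not> p dvd k"
          then have "k \<in> ?C" using m k p0 by (auto simp: Suc_le_eq intro: order_trans[of k "p * k"])
          with k m show False by blast
        qed
        then have "moebius_mu m = 0"
          using p k by (intro moebius_mu_not_squarefree) (simp add: squarefree_prime_mult_iff)
        then show "?f m = 0" by simp
      qed
    qed auto
    also have "\<dots> = sum ?f ?B + sum ?f ((*) p ` ?C)"
      by (intro sum.union_disjoint) auto
    finally show ?thesis .
  qed
  also have "sum ?f ((*) p ` ?C) = (\<Sum>m\<in>?C. ?f (p * m))"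
    using p0 by (subst sum.reindex) (auto simp: inj_on_def)
  also have "\<dots> = (\<Sum>m\<in>?C. - (real p powr - s * (moebius_mu m * real m powr - s * log_plus (x / real p / real m))))"
    using p by (intro sum.cong refl) (auto simp: moebius_mu_prime_mult powr_mult)
  also have "\<dots> = (\<Sum>m\<in>?B. - (real p powr - s * (moebius_mu m * real m powr - s * log_plus (x / real p / real m))))"
  proof (rule sum.mono_neutral_left)
    show "\<forall>m\<in>?B - ?C. - (real p powr - s * (moebius_mu m * real m powr - s * log_plus (x / real p / real m))) = 0"
    proof
      fix m assume m: "m \<in> ?B - ?C"
      then have "real (M + 1) \<le> real (p * m)" by (intro of_nat_mono) auto
      then have "x / (real p * real m) \<le> 1" "x / (real p * real m) > 0"
        using m p0 x by (auto simp: divide_le_eq)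
      then show "- (real p powr - s * (moebius_mu m * real m powr - s * log_plus (x / real p / real m))) = 0"
        by (simp add: log_plus_eq_0)
    qed
  qed auto
  finally show ?thesis
    by (simp add: coprime_log_sum_def sum_negf sum_distrib_left)
qed

text \<open>Iterating the recursion expresses the sum without p as the series of p^(-k s) times the
  old sum at x / p^k. All terms are nonnegative, and the geometric series yields the new Euler
  factor. Arguments below 1 are included because the recursion ends there; the sum is then 0,
  whereas 1 + \<epsilon> ln x could be negative.\<close>

lemma coprime_log_sum_bounds:
  fixes \<epsilon> x :: real
  assumes \<epsilon>: "\<epsilon> > 0" and "finite P" "\<And>q. q \<in> P \<Longrightarrow> prime q" and x: "0 < x" "x < real M + 1"
  shows "coprime_log_sum P M (1 + \<epsilon>) x
    \<in> {0..(\<Prod>p\<in>P. 1 / (1 - real p powr - (1 + \<epsilon>))) * (if x < 1 then 0 else 1.082 * (1 + \<epsilon> * ln x))}"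
  using assms(2,3) x
proof (induction P arbitrary: x rule: finite_induct)
  case empty
  moreover have "{m. m \<in> {1..M} \<and> (\<forall>p\<in>{}. \<not> p dvd m)} = {1..M}" by auto
  ultimately show ?case
    using coprime_log_sum_eq_0[of x "{}" M "1 + \<epsilon>"] sum_moebius_powr_log_plus_bounds[OF \<epsilon>, of x M]
    unfolding coprime_log_sum_def by (cases "x < 1") auto
next
  case (insert p P)
  define B where "B x = (if x < 1 then 0 else 1.082 * (1 + \<epsilon> * ln x))" for x
  define K where "K = (\<Prod>p\<in>P. 1 / (1 - real p powr - (1 + \<epsilon>)))"
  define a where "a = real p powr - (1 + \<epsilon>)"
  have p: "prime p" "p > 1" using insert prime_gt_1_nat by auto
  have less1: "0 < real q powr - (1 + \<epsilon>)" "real q powr - (1 + \<epsilon>) < 1" if "prime q" for q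
    using prime_gt_1_nat[OF that] \<epsilon> by (auto simp: powr_less_one)
  have a: "0 < a" "a < 1" using less1[OF p(1)] by (auto simp: a_def)
  have K: "K \<ge> 0" unfolding K_def using insert.prems(1) less1
    by (intro prod_nonneg) (auto simp: less_imp_le)
  have IH: "coprime_log_sum P M (1 + \<epsilon>) y \<in> {0..K * B y}" if "0 < y" "y < real M + 1" for y
    using insert.IH[of y] insert.prems(1) that by (auto simp: K_def B_def)
  have B_mono: "B (y / real p) \<le> B y" if "y > 0" for y
  proof -
    have "y / real p \<le> y" using p that by (simp add: field_simps)
    moreover have "0 \<le> B y" using \<epsilon> by (simp add: B_def)
    ultimately show ?thesis using \<epsilon> that by (auto simp: B_def)
  qed
  have "coprime_log_sum (insert p P) M (1 + \<epsilon>) y \<in> {0..K / (1 - a) * B y}"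
    if "0 < y" "y < real M + 1" for y
    using that
  \<comment> \<open>Since p \<ge> 2, passing from y \<ge> 1 to y / p lowers the integer
    part.\<close>
  proof (induction "nat \<lfloor>y\<rfloor>" arbitrary: y rule: less_induct)
    case less
    show ?case
    proof (cases "y < 1")
      case True
      then show ?thesis using less coprime_log_sum_eq_0[of y] by (simp add: B_def)
    next
      case False
      have py: "y / real p < y" "0 < y / real p" using p less by (auto simp: field_simps)
      have "y / real p \<le> y / 2" using p less by (intro divide_left_mono) auto
      moreover have "1 \<le> \<lfloor>y\<rfloor>" using False by simp
      ultimately have "\<lfloor>y / real p\<rfloor> < \<lfloor>y\<rfloor>" by linarith
      with \<open>1 \<le> \<lfloor>y\<rfloor>\<close> have "nat \<lfloor>y / real p\<rfloor> < nat \<lfloor>y\<rfloor>" by linarith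
      then have h: "coprime_log_sum (insert p P) M (1 + \<epsilon>) (y / real p) \<in> {0..K / (1 - a) * B (y / real p)}"
        using py less.prems by (intro less.hyps) auto
      have eq: "coprime_log_sum (insert p P) M (1 + \<epsilon>) y = coprime_log_sum P M (1 + \<epsilon>) y
          + a * coprime_log_sum (insert p P) M (1 + \<epsilon>) (y / real p)"
        unfolding a_def using insert less.prems p by (intro coprime_log_sum_insert) auto
      have "a * coprime_log_sum (insert p P) M (1 + \<epsilon>) (y / real p) \<le> a * (K / (1 - a) * B y)"
        using h a K B_mono[of y] less.prems
        by (intro mult_left_mono order_trans[OF _ mult_left_mono[OF B_mono[of y]]]) auto
      \<comment> \<open>K / (1 - a) is the fixed point of c = K + a c, so the bound reproduces
        itself.\<close>
      moreover have "K * B y + a * (K / (1 - a) * B y) = K / (1 - a) * B y"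
        using a by (simp add: field_simps)
      ultimately show ?thesis unfolding eq using IH[of y] h a less.prems by auto
    qed
  qed
  moreover have "(\<Prod>q\<in>insert p P. 1 / (1 - real q powr - (1 + \<epsilon>))) = K / (1 - a)"
    using insert by (simp add: K_def a_def)
  ultimately show ?case using insert.prems by (simp add: B_def)
qed

section \<open>Diagonalising the quadratic form\<close>

text \<open>This is Jordan's totient J_s at squarefree n; at other positive n it is J_s of the
  radical. The product over primes keeps it positive everywhere and makes induction over squarefree
  numbers direct.\<close>

definition jordan :: "real \<Rightarrow> nat \<Rightarrow> real" where
  "jordan s n = (\<Prod>p\<in>prime_factors n. real p powr s - 1)"

lemma jordan_prime_mult:
  assumes "prime p" "\<not> p dvd n"
  shows "jordan s (p * n) = (real p powr s - 1) * jordan s n"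
proof -
  have "n > 0" using assms by (intro gr0I) auto
  moreover have "p \<notin> prime_factors n" using assms by auto
  ultimately show ?thesis using assms by (simp add: jordan_def prime_factors_prime_mult)
qed

lemma jordan_pos:
  assumes "s > 0"
  shows "jordan s n > 0"
  unfolding jordan_def
proof (intro prod_pos)
  fix p assume "p \<in> prime_factors n"
  then have "real p > 1" using prime_gt_1_nat by (auto dest: in_prime_factors_imp_prime)
  then have "real p powr 0 < real p powr s" using assms by (intro powr_less_mono) auto
  then show "0 < real p powr s - 1" using \<open>real p > 1\<close> by simp
qed

lemma squarefree_induct [consumes 1, case_names one prime_mult]:
  fixes n :: nat
  assumes "squarefree n" and "P 1"
    and "\<And>p n. prime p \<Longrightarrow> squarefree n \<Longrightarrow> \<not> p dvd n \<Longrightarrow> P n \<Longrightarrow> P (p * n)"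
  shows "P n"
  using assms(1)
proof (induction n rule: less_induct)
  case (less n)
  show ?case
  proof (cases "n = 1")
    case False
    then obtain p where p: "prime p" "p dvd n" using prime_factor_nat by blast
    then obtain k where k: "n = p * k" by (elim dvdE)
    then have "squarefree k" "\<not> p dvd k"
      using less.prems squarefree_prime_mult_iff[OF p(1), of k] by auto
    moreover have "k < n" using k p squarefree_pos[OF less.prems] prime_gt_1_nat[of p] by auto
    ultimately show ?thesis using assms(3)[OF p(1)] less.IH k by blast
  qed (use assms in simp)
qed

lemma sum_jordan_divisors:
  assumes "squarefree n"
  shows "(\<Sum>r | r dvd n. jordan s r) = real n powr s"
  using assms
proof (induction n rule: squarefree_induct)
  case one
  then show ?case by (simp add: jordan_def)
next
  case (prime_mult p n)
  have n: "n > 0" "p > 0" using prime_mult squarefree_pos prime_gt_0_nat by auto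
  have sf: "squarefree (p * n)" using prime_mult by (simp add: squarefree_prime_mult_iff)
  have "(\<Sum>r | r dvd p * n. jordan s r) = (\<Sum>r | r dvd p * n \<and> squarefree r. jordan s r)"
    using sf squarefree_mono by (intro sum.cong) auto
  also have "\<dots> = (\<Sum>r | r dvd p * n \<and> squarefree r \<and> \<not> p dvd r. jordan s r + jordan s (p * r))"
    using prime_mult n by (intro sum_squarefree_divisors_prime) auto
  also have "\<dots> = (\<Sum>r | r dvd n. real p powr s * jordan s r)"
  proof (intro sum.cong)
    show "{r. r dvd p * n \<and> squarefree r \<and> \<not> p dvd r} = {r. r dvd n}"
    proof (intro Collect_cong iffI)
      show "r dvd n" if "r dvd p * n \<and> squarefree r \<and> \<not> p dvd r" for r
        using that prime_mult(1) by (meson coprime_commute coprime_dvd_mult_right_iff prime_imp_coprime)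
      show "r dvd p * n \<and> squarefree r \<and> \<not> p dvd r" if "r dvd n" for r
        using that prime_mult squarefree_mono dvd_trans by auto
    qed
    show "jordan s r + jordan s (p * r) = real p powr s * jordan s r" if "r \<in> {r. r dvd n}" for r
    proof -
      have "\<not> p dvd r" using that prime_mult dvd_trans by blast
      then show ?thesis using prime_mult by (simp add: jordan_prime_mult algebra_simps)
    qed
  qed
  also have "\<dots> = real (p * n) powr s"
    using prime_mult by (simp add: powr_mult flip: sum_distrib_left)
  finally show ?case .
qed

text \<open>This converts the Euler product in \<open>coprime_log_sum_bounds\<close> into r^s /
  J_s(r), which cancels the diagonal weight J_s(r).\<close>

lemma jordan_euler_product:
  assumes "s > 0" "squarefree r"
  shows "jordan s r * (\<Prod>p\<in>prime_factors r. 1 / (1 - real p powr - s)) = real r powr s"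
  using assms(2)
proof (induction r rule: squarefree_induct)
  case one
  then show ?case by (simp add: jordan_def)
next
  case (prime_mult p n)
  have p: "real p > 1" using prime_mult(1) prime_gt_1_nat by simp
  have "real p powr 0 < real p powr s" using p assms by (intro powr_less_mono) auto
  then have "real p powr s - 1 \<noteq> 0" using p assms by simp
  moreover have "1 - real p powr - s = (real p powr s - 1) / real p powr s"
    using p by (simp add: powr_minus field_simps)
  ultimately have "(real p powr s - 1) * (1 / (1 - real p powr - s)) = real p powr s" by simp
  moreover have "n > 0" "p \<notin> prime_factors n" using prime_mult by (auto simp: squarefree_pos)
  then have "jordan s (p * n) * (\<Prod>q\<in>prime_factors (p * n). 1 / (1 - real q powr - s))
      = ((real p powr s - 1) * (1 / (1 - real p powr - s)))
        * (jordan s n * (\<Prod>q\<in>prime_factors n. 1 / (1 - real q powr - s)))"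
    using prime_mult by (simp add: jordan_prime_mult prime_factors_prime_mult)
  ultimately show ?case using prime_mult.IH by (simp only: powr_mult of_nat_mult)
qed

lemma moebius_mu_mult:
  assumes "squarefree r" "coprime r m"
  shows "moebius_mu (r * m) = moebius_mu r * moebius_mu m"
  using assms
proof (induction r rule: squarefree_induct)
  case (prime_mult p n)
  then have "coprime p m" "coprime n m" by simp_all
  then have "\<not> p dvd n * m"
    using prime_mult by (metis coprime_absorb_left not_prime_unit prime_dvd_mult_iff)
  then show ?case using prime_mult \<open>coprime n m\<close> by (simp add: moebius_mu_prime_mult mult.assoc)
qed simp

lemma lcm_powr_eq_sum_jordan:
  fixes d e :: nat
  assumes "squarefree d" "e > 0"
  shows "real (lcm d e) powr - s = real d powr - s * real e powr - s * (\<Sum>r | r dvd d \<and> r dvd e. jordan s r)"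
proof -
  have d: "d > 0" using assms squarefree_pos by auto
  have "{r. r dvd d \<and> r dvd e} = {r. r dvd gcd d e}" by auto
  then have J: "(\<Sum>r | r dvd d \<and> r dvd e. jordan s r) = real (gcd d e) powr s"
    using sum_jordan_divisors[of "gcd d e" s] squarefree_mono[OF gcd_dvd1 assms(1)] by simp
  have "real (gcd d e) * real (lcm d e) = real d * real e"
    using prod_gcd_lcm_nat[of d e] by (metis of_nat_mult)
  then have "real (gcd d e) powr - s * real (lcm d e) powr - s = real d powr - s * real e powr - s"
    by (simp flip: powr_mult)
  moreover have "real (gcd d e) powr - s * real (gcd d e) powr s = 1"
    using d by (simp add: powr_minus)
  ultimately show ?thesis unfolding J by (metis mult.assoc mult.commute mult.right_neutral)
qed

lemma quadratic_form_diagonal: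
  fixes w :: "nat \<Rightarrow> real"
  assumes "\<And>d. \<not> squarefree d \<Longrightarrow> w d = 0"
  shows "(\<Sum>d=1..M. \<Sum>e=1..M. w d * w e * real (lcm d e) powr - s)
    = (\<Sum>r=1..M. jordan s r * (\<Sum>d | d \<in> {1..M} \<and> r dvd d. w d * real d powr - s)\<^sup>2)"
proof -
  define f where "f d = w d * real d powr - s" for d
  have "(\<Sum>d=1..M. \<Sum>e=1..M. w d * w e * real (lcm d e) powr - s)
      = (\<Sum>d=1..M. \<Sum>e=1..M. \<Sum>r=1..M. if r dvd d \<and> r dvd e then jordan s r * (f d * f e) else 0)"
  proof (intro sum.cong refl)
    fix d e assume de: "d \<in> {1..M}" "e \<in> {1..M}"
    show "w d * w e * real (lcm d e) powr - s
        = (\<Sum>r=1..M. if r dvd d \<and> r dvd e then jordan s r * (f d * f e) else 0)"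
    proof (cases "squarefree d")
      case True
      have "{r. r dvd d \<and> r dvd e} = {r \<in> {1..M}. r dvd d \<and> r dvd e}"
        using de by (auto dest: dvd_imp_le intro: Suc_leI dvd_pos_nat)
      then have "w d * w e * real (lcm d e) powr - s
          = f d * f e * (\<Sum>r | r \<in> {1..M} \<and> r dvd d \<and> r dvd e. jordan s r)"
        using lcm_powr_eq_sum_jordan[OF True, of e s] de by (simp add: f_def)
      then show ?thesis
        by (simp only: sum_distrib_left sum.inter_filter[symmetric] finite_atLeastAtMost mult.commute)
    next
      case False
      then have "w d = 0" "f d = 0" using assms by (simp_all add: f_def)
      then show ?thesis by (simp cong: if_cong)
    qed
  qed
  also have "\<dots> = (\<Sum>r=1..M. \<Sum>d=1..M. \<Sum>e=1..M. if r dvd d \<and> r dvd e then jordan s r * (f d * f e) else 0)"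
    by (subst (2) sum.swap, subst sum.swap) (rule refl)
  also have "\<dots> = (\<Sum>r=1..M. jordan s r * (\<Sum>d | d \<in> {1..M} \<and> r dvd d. f d)\<^sup>2)"
  proof (intro sum.cong refl)
    fix r
    have inner: "(\<Sum>d | d \<in> {1..M} \<and> r dvd d. f d) = (\<Sum>d=1..M. if r dvd d then f d else 0)"
      by (rule sum.inter_filter) simp
    have "jordan s r * (\<Sum>d | d \<in> {1..M} \<and> r dvd d. f d)\<^sup>2
        = (\<Sum>d=1..M. \<Sum>e=1..M. jordan s r * ((if r dvd d then f d else 0) * (if r dvd e then f e else 0)))"
      unfolding power2_eq_square inner sum_product
      unfolding sum_distrib_left by (rule refl)
    also have "\<dots> = (\<Sum>d=1..M. \<Sum>e=1..M. if r dvd d \<and> r dvd e then jordan s r * (f d * f e) else 0)"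
      by (intro sum.cong refl) auto
    finally show "(\<Sum>d=1..M. \<Sum>e=1..M. if r dvd d \<and> r dvd e then jordan s r * (f d * f e) else 0)
      = jordan s r * (\<Sum>d | d \<in> {1..M} \<and> r dvd d. f d)\<^sup>2" by simp
  qed
  finally show ?thesis by (simp add: f_def)
qed

text \<open>A squarefree multiple of r is r * m with m coprime to r, and \<mu> factors there. Those
  m with r * m > M lie in the range of \<open>coprime_log_sum\<close> as well, but there
  \<open>log_plus\<close> is 0 because z < M + 1.\<close>

lemma sum_multiples_moebius_log_plus:
  assumes r: "1 \<le> r" "squarefree r" and z: "0 < z" "z < real M + 1"
  shows "(\<Sum>d | d \<in> {1..M} \<and> r dvd d. moebius_mu d * log_plus (z / real d) * real d powr - s)
    = moebius_mu r * real r powr - s * coprime_log_sum (prime_factors r) M s (z / real r)"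
proof -
  let ?f = "\<lambda>d. moebius_mu d * log_plus (z / real d) * real d powr - s"
  let ?B = "{m. m \<in> {1..M} \<and> (\<forall>p\<in>prime_factors r. \<not> p dvd m)}"
  let ?C = "{m\<in>?B. r * m \<le> M}"
  have cop: "coprime r m \<longleftrightarrow> (\<forall>p\<in>prime_factors r. \<not> p dvd m)" if "m > 0" for m
  proof -
    have "coprime r m \<longleftrightarrow> (\<forall>p. prime p \<and> p dvd r \<longrightarrow> \<not> p dvd m)"
      using r coprime_common_divisor_nat[of r m] prime_factor_nat[of "gcd r m"]
      by (metis coprime_iff_gcd_eq_1 gcd_greatest dvd_trans gcd_dvd1 gcd_dvd2 not_prime_1 dvd_1_iff_1)
    then show ?thesis using r by (auto simp: prime_factors_dvd)
  qed
  have "(\<Sum>d | d \<in> {1..M} \<and> r dvd d. ?f d) = (\<Sum>d\<in>(*) r ` ?C. ?f d)"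
  proof (rule sum.mono_neutral_right)
    show "(*) r ` ?C \<subseteq> {d. d \<in> {1..M} \<and> r dvd d}" using r by (auto simp: Suc_le_eq)
    show "\<forall>d\<in>{d. d \<in> {1..M} \<and> r dvd d} - (*) r ` ?C. ?f d = 0"
    proof
      fix d assume d: "d \<in> {d. d \<in> {1..M} \<and> r dvd d} - (*) r ` ?C"
      then obtain k where k: "d = r * k" by auto
      have "\<not> squarefree d"
      proof
        assume sf: "squarefree d"
        have "\<not> p dvd k" if "p \<in> prime_factors r" for p
        proof -
          have p: "prime p" "p dvd r" using that by auto
          then obtain t where "r = p * t" by (elim dvdE)
          then show ?thesis
            using sf k squarefree_prime_mult_iff[OF p(1), of "t * k"] by (auto simp: mult.assoc)
        qed
        then have "k \<in> ?C" using d k r by (auto simp: Suc_le_eq intro: order_trans[of k "r * k"])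
        with k d show False by blast
      qed
      then show "?f d = 0" by (simp add: moebius_mu_not_squarefree)
    qed
  qed auto
  also have "\<dots> = (\<Sum>m\<in>?C. ?f (r * m))"
    using r by (subst sum.reindex) (auto simp: inj_on_def)
  also have "\<dots> = (\<Sum>m\<in>?C. moebius_mu r * real r powr - s * (moebius_mu m * real m powr - s * log_plus (z / real r / real m)))"
    using moebius_mu_mult[OF r(2)] cop by (intro sum.cong refl) (auto simp: powr_mult)
  also have "\<dots> = (\<Sum>m\<in>?B. moebius_mu r * real r powr - s * (moebius_mu m * real m powr - s * log_plus (z / real r / real m)))"
  proof (rule sum.mono_neutral_left)
    show "\<forall>m\<in>?B - ?C. moebius_mu r * real r powr - s * (moebius_mu m * real m powr - s * log_plus (z / real r / real m)) = 0"
    proof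
      fix m assume m: "m \<in> ?B - ?C"
      then have "real (M + 1) \<le> real (r * m)" by (intro of_nat_mono) auto
      then have "z / (real r * real m) \<le> 1" "z / (real r * real m) > 0"
        using m r z by (auto simp: divide_le_eq)
      then show "moebius_mu r * real r powr - s * (moebius_mu m * real m powr - s * log_plus (z / real r / real m)) = 0"
        by (simp add: log_plus_eq_0)
    qed
  qed auto
  finally show ?thesis by (simp add: coprime_log_sum_def sum_distrib_left)
qed

section \<open>Evaluating the linear sum over r by collecting n = r * m\<close>

lemma sum_reindex_squarefree:
  fixes h :: "nat \<Rightarrow> nat \<Rightarrow> real"
  shows "(\<Sum>r | r \<in> {1..M} \<and> squarefree r. \<Sum>m | m \<in> {1..M div r} \<and> (\<forall>p\<in>prime_factors r. \<not> p dvd m) \<and> squarefree m. h r m)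
    = (\<Sum>n | n \<in> {1..M} \<and> squarefree n. \<Sum>m | m dvd n. h (n div m) m)"
proof -
  have sf: "squarefree (r * m) \<longleftrightarrow> squarefree r \<and> squarefree m \<and> (\<forall>p\<in>prime_factors r. \<not> p dvd m)" if "r > 0" for r m :: nat
  proof
    assume s: "squarefree (r * m)"
    have "\<not> p dvd m" if "p \<in> prime_factors r" for p
    proof -
      have p: "prime p" "p dvd r" using that by auto
      then obtain t where "r = p * t" by (elim dvdE)
      then show ?thesis
        using s squarefree_prime_mult_iff[OF p(1), of "t * m"] by (auto simp: mult.assoc)
    qed
    then show "squarefree r \<and> squarefree m \<and> (\<forall>p\<in>prime_factors r. \<not> p dvd m)"
      using s squarefree_multD by blast
  next
    assume *: "squarefree r \<and> squarefree m \<and> (\<forall>p\<in>prime_factors r. \<not> p dvd m)"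
    then have "coprime r m"
      using that coprime_common_divisor_nat[of r m] prime_factor_nat[of "gcd r m"]
      by (metis coprime_iff_gcd_eq_1 gcd_dvd1 gcd_dvd2 dvd_trans prime_factorsI not_less_zero gr0I)
    with * show "squarefree (r * m)" by (intro squarefree_mult_coprime) auto
  qed
  have "(\<Sum>r | r \<in> {1..M} \<and> squarefree r. \<Sum>m | m \<in> {1..M div r} \<and> (\<forall>p\<in>prime_factors r. \<not> p dvd m) \<and> squarefree m. h r m)
    = (\<Sum>(r,m)\<in>(SIGMA r:{r. r \<in> {1..M} \<and> squarefree r}. {m. m \<in> {1..M div r} \<and> (\<forall>p\<in>prime_factors r. \<not> p dvd m) \<and> squarefree m}). h r m)"
    by (subst sum.Sigma) auto
  also have "\<dots> = (\<Sum>(n,m)\<in>(SIGMA n:{n. n \<in> {1..M} \<and> squarefree n}. {m. m dvd n}). h (n div m) m)"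
  proof (rule sum.reindex_bij_witness[where i = "\<lambda>(n,m). (n div m, m)" and j = "\<lambda>(r,m). (r * m, m)"], goal_cases)
    case (2 a)
    then show ?case using sf by (auto simp: Suc_le_eq less_eq_div_iff_mult_less_eq mult.commute)
  next
    case (4 a)
    then obtain n m where a: "a = (n, m)" "m dvd n" "1 \<le> n" "n \<le> M" "squarefree n" by auto
    then obtain r where r: "n = r * m" by (metis dvdE mult.commute)
    then have "r > 0" "m > 0" using a by auto
    with a r sf[of r m] show ?case
      by (auto simp: less_eq_div_iff_mult_less_eq Suc_le_eq mult.commute intro: order_trans[of r "r * m"])
  qed auto
  also have "\<dots> = (\<Sum>n | n \<in> {1..M} \<and> squarefree n. \<Sum>m | m dvd n. h (n div m) m)"
    by (subst sum.Sigma) auto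
  finally show ?thesis .
qed

text \<open>For n = r * m the weight is 1 + \<epsilon> ln(z/n) + \<epsilon> ln m. Against \<mu>(m)
  the part free of m survives only at n = 1, and \<epsilon> ln m leaves the nonpositive divisor
  sums, of which the prime n are retained as a saving.\<close>

lemma sum_weighted_coprime_log_sum:
  fixes \<epsilon> z :: real
  assumes \<epsilon>: "\<epsilon> > 0" and z: "1 \<le> z" "z < real M + 1"
  shows "(\<Sum>r | r \<in> {1..M} \<and> squarefree r. real r powr - (1 + \<epsilon>) * (1 + \<epsilon> * ln (z / real r))
      * coprime_log_sum (prime_factors r) M (1 + \<epsilon>) (z / real r))
    \<le> ln z * (1 + \<epsilon> * ln z) - \<epsilon> * (\<Sum>p | p \<in> {1..M} \<and> prime p. real p powr - (1 + \<epsilon>) * log_plus (z / real p) * ln (real p))"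
proof -
  define s where "s = 1 + \<epsilon>"
  define g where "g n = real n powr - s * log_plus (z / real n)" for n
  have g: "g n \<ge> 0" for n by (simp add: g_def)
  let ?h = "\<lambda>r m. (1 + \<epsilon> * ln (z / real r)) * (moebius_mu m * g (r * m))"
  have "(\<Sum>r | r \<in> {1..M} \<and> squarefree r. real r powr - s * (1 + \<epsilon> * ln (z / real r))
      * coprime_log_sum (prime_factors r) M s (z / real r))
    = (\<Sum>r | r \<in> {1..M} \<and> squarefree r. \<Sum>m | m \<in> {1..M div r} \<and> (\<forall>p\<in>prime_factors r. \<not> p dvd m) \<and> squarefree m. ?h r m)"
  proof (intro sum.cong refl)
    fix r assume r: "r \<in> {r. r \<in> {1..M} \<and> squarefree r}"
    have "real r powr - s * (1 + \<epsilon> * ln (z / real r)) * coprime_log_sum (prime_factors r) M s (z / real r)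
        = (\<Sum>m | m \<in> {1..M} \<and> (\<forall>p\<in>prime_factors r. \<not> p dvd m). ?h r m)"
      unfolding coprime_log_sum_def sum_distrib_left
      by (intro sum.cong refl) (simp add: g_def powr_mult)
    also have "\<dots> = (\<Sum>m | m \<in> {1..M div r} \<and> (\<forall>p\<in>prime_factors r. \<not> p dvd m) \<and> squarefree m. ?h r m)"
    proof (rule sum.mono_neutral_right)
      show "\<forall>m\<in>{m. m \<in> {1..M} \<and> (\<forall>p\<in>prime_factors r. \<not> p dvd m)} -
          {m. m \<in> {1..M div r} \<and> (\<forall>p\<in>prime_factors r. \<not> p dvd m) \<and> squarefree m}. ?h r m = 0"
      proof
        fix m assume m: "m \<in> {m. m \<in> {1..M} \<and> (\<forall>p\<in>prime_factors r. \<not> p dvd m)} -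
          {m. m \<in> {1..M div r} \<and> (\<forall>p\<in>prime_factors r. \<not> p dvd m) \<and> squarefree m}"
        show "?h r m = 0"
        proof (cases "squarefree m")
          case True
          then have "M < r * m" using m r by (auto simp: less_eq_div_iff_mult_less_eq mult.commute)
          then have "real (M + 1) \<le> real (r * m)" by (intro of_nat_mono) auto
          then have "z / real (r * m) \<le> 1" "0 < z / real (r * m)" using m r z by (auto simp: divide_le_eq)
          then have "g (r * m) = 0" unfolding g_def by (simp add: log_plus_eq_0)
          then show ?thesis by simp
        qed (simp add: moebius_mu_not_squarefree)
      qed
    qed (auto intro: order_trans[OF _ div_le_dividend])
    finally show "real r powr - s * (1 + \<epsilon> * ln (z / real r)) * coprime_log_sum (prime_factors r) M s (z / real r)
        = (\<Sum>m | m \<in> {1..M div r} \<and> (\<forall>p\<in>prime_factors r. \<not> p dvd m) \<and> squarefree m. ?h r m)" .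
  qed
  also have "\<dots> = (\<Sum>n | n \<in> {1..M} \<and> squarefree n. \<Sum>m | m dvd n. ?h (n div m) m)"
    by (rule sum_reindex_squarefree)
  also have "\<dots> = (\<Sum>n | n \<in> {1..M} \<and> squarefree n. g n * ((1 + \<epsilon> * ln (z / real n)) * (\<Sum>m | m dvd n. moebius_mu m)
      + \<epsilon> * (\<Sum>m | m dvd n. moebius_mu m * ln (real m))))"
  proof (intro sum.cong refl)
    fix n assume n: "n \<in> {n. n \<in> {1..M} \<and> squarefree n}"
    have "?h (n div m) m = g n * ((1 + \<epsilon> * ln (z / real n)) * moebius_mu m + \<epsilon> * (moebius_mu m * ln (real m)))"
      if "m dvd n" for m
    proof -
      have "m > 0" "n > 0" using that n by (auto intro: dvd_pos_nat)
      then have "ln (z / real (n div m)) = ln (z / real n) + ln (real m)"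
        using that z by (simp add: real_of_nat_div ln_div ln_mult)
      then show ?thesis using that by (simp add: algebra_simps)
    qed
    then show "(\<Sum>m | m dvd n. ?h (n div m) m) = g n * ((1 + \<epsilon> * ln (z / real n)) * (\<Sum>m | m dvd n. moebius_mu m)
      + \<epsilon> * (\<Sum>m | m dvd n. moebius_mu m * ln (real m)))"
      by (simp add: sum_distrib_left sum.distrib distrib_left)
  qed
  also have "\<dots> \<le> (\<Sum>n | n \<in> {1..M} \<and> squarefree n. (if n = 1 then ln z * (1 + \<epsilon> * ln z) else 0)
      - (if prime n then \<epsilon> * (g n * ln (real n)) else 0))"
  proof (intro sum_mono)
    fix n assume n: "n \<in> {n. n \<in> {1..M} \<and> squarefree n}"
    then have n0: "n > 0" by auto
    show "g n * ((1 + \<epsilon> * ln (z / real n)) * (\<Sum>m | m dvd n. moebius_mu m)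
      + \<epsilon> * (\<Sum>m | m dvd n. moebius_mu m * ln (real m)))
      \<le> (if n = 1 then ln z * (1 + \<epsilon> * ln z) else 0) - (if prime n then \<epsilon> * (g n * ln (real n)) else 0)"
    proof (cases "n = 1")
      case True
      then show ?thesis using z by (simp add: g_def log_plus_eq_ln)
    next
      case False
      have "\<epsilon> * (g n * (\<Sum>m | m dvd n. moebius_mu m * ln (real m))) \<le> 0"
        using sum_moebius_ln_divisors_le_0[OF n0] g[of n] \<epsilon> by (simp add: mult_le_0_iff)
      then show ?thesis
        using False sum_moebius_divisors[OF n0] sum_moebius_ln_divisors_prime[of n] \<epsilon>
        by (auto simp: algebra_simps)
    qed
  qed
  also have "\<dots> = ln z * (1 + \<epsilon> * ln z) - \<epsilon> * (\<Sum>p | p \<in> {1..M} \<and> prime p. g p * ln (real p))"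
  proof -
    have "M \<ge> 1" using z by linarith
    then have "(\<Sum>n | n \<in> {1..M} \<and> squarefree n. if n = 1 then ln z * (1 + \<epsilon> * ln z) else 0) = ln z * (1 + \<epsilon> * ln z)"
      by (subst sum.delta) auto
    moreover have "{n. (n \<in> {1..M} \<and> squarefree n) \<and> prime n} = {p. p \<in> {1..M} \<and> prime p}"
      using squarefree_prime by auto
    then have "(\<Sum>n | n \<in> {1..M} \<and> squarefree n. if prime n then \<epsilon> * (g n * ln (real n)) else 0)
        = (\<Sum>p | p \<in> {1..M} \<and> prime p. \<epsilon> * (g p * ln (real p)))"
      by (subst sum.inter_filter[symmetric]) auto
    ultimately show ?thesis by (simp add: sum_subtractf sum_distrib_left)
  qed
  finally show ?thesis by (simp add: s_def g_def)
qed

lemma sum_jordan_coprime_log_sum_sq: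
  fixes \<epsilon> z :: real
  assumes \<epsilon>: "\<epsilon> > 0" and z: "1 \<le> z" "z < real M + 1"
  shows "(\<Sum>r | r \<in> {1..M} \<and> squarefree r. jordan (1 + \<epsilon>) r * (real r powr - (1 + \<epsilon>) * coprime_log_sum (prime_factors r) M (1 + \<epsilon>) (z / real r))\<^sup>2)
    \<le> 1.082 * (ln z * (1 + \<epsilon> * ln z) - \<epsilon> * (\<Sum>p | p \<in> {1..M} \<and> prime p. real p powr - (1 + \<epsilon>) * log_plus (z / real p) * ln (real p)))"
proof -
  define s where "s = 1 + \<epsilon>"
  define H where "H r = coprime_log_sum (prime_factors r) M s (z / real r)" for r
  have "(\<Sum>r | r \<in> {1..M} \<and> squarefree r. jordan s r * (real r powr - s * H r)\<^sup>2)
    \<le> (\<Sum>r | r \<in> {1..M} \<and> squarefree r. 1.082 * (real r powr - s * (1 + \<epsilon> * ln (z / real r)) * H r))"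
  proof (intro sum_mono)
    fix r assume r: "r \<in> {r. r \<in> {1..M} \<and> squarefree r}"
    have zr: "0 < z / real r" "z / real r < real M + 1"
    proof -
      have "z / real r \<le> z" using r z by (simp add: divide_le_eq)
      then show "0 < z / real r" "z / real r < real M + 1" using r z by auto
    qed
    show "jordan s r * (real r powr - s * H r)\<^sup>2 \<le> 1.082 * (real r powr - s * (1 + \<epsilon> * ln (z / real r)) * H r)"
    proof (cases "z / real r < 1")
      case True
      then show ?thesis using zr coprime_log_sum_eq_0 by (simp add: H_def)
    next
      case False
      define K where "K = (\<Prod>p\<in>prime_factors r. 1 / (1 - real p powr - s))"
      have H: "0 \<le> H r" "H r \<le> K * (1.082 * (1 + \<epsilon> * ln (z / real r)))"
        using coprime_log_sum_bounds[OF \<epsilon>, of "prime_factors r" "z / real r" M] zr False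
        by (auto simp: H_def s_def K_def dest: in_prime_factors_imp_prime)
      have J: "jordan s r * K = real r powr s"
        unfolding K_def using r \<epsilon> by (intro jordan_euler_product) (auto simp: s_def)
      \<comment> \<open>Only one of the two factors \<open>H r\<close> is bounded; the other is kept
        so that the sum over r stays linear.\<close>
      have "jordan s r * H r \<le> jordan s r * (K * (1.082 * (1 + \<epsilon> * ln (z / real r))))"
        using H jordan_pos[of s r] \<epsilon> by (intro mult_left_mono) (auto simp: s_def)
      also have "\<dots> = real r powr s * (1.082 * (1 + \<epsilon> * ln (z / real r)))"
        unfolding J[symmetric] by simp
      finally have "(jordan s r * H r) * (real r powr - s * real r powr - s * H r)
        \<le> (real r powr s * (1.082 * (1 + \<epsilon> * ln (z / real r)))) * (real r powr - s * real r powr - s * H r)"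
        using H by (intro mult_right_mono) auto
      also have "\<dots> = (real r powr s * real r powr - s) * (1.082 * (real r powr - s * (1 + \<epsilon> * ln (z / real r)) * H r))"
        by (simp add: mult_ac)
      also have "real r powr s * real r powr - s = 1" using r by (simp add: powr_minus)
      finally show ?thesis by (simp add: power2_eq_square mult_ac)
    qed
  qed
  also have "\<dots> = 1.082 * (\<Sum>r | r \<in> {1..M} \<and> squarefree r. real r powr - s * (1 + \<epsilon> * ln (z / real r)) * H r)"
    by (simp only: sum_distrib_left)
  also have "\<dots> \<le> 1.082 * (ln z * (1 + \<epsilon> * ln z) - \<epsilon> * (\<Sum>p | p \<in> {1..M} \<and> prime p. real p powr - (1 + \<epsilon>) * log_plus (z / real p) * ln (real p)))"
    using sum_weighted_coprime_log_sum[OF assms] by (intro mult_left_mono) (auto simp: H_def s_def)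
  finally show ?thesis by (simp only: H_def s_def)
qed

section \<open>The zeta function near 1\<close>

text \<open>The right side is the integral of t^(-1-\<epsilon>) over [n - 1/2, n + 1/2], which
  exceeds the midpoint value by convexity. With x as the half-width, the derivative of integral
  minus 2 x times midpoint value is the convexity defect.\<close>

lemma powr_minus_le_integral:
  fixes \<epsilon> :: real and n :: nat
  assumes \<epsilon>: "\<epsilon> > 0" and n: "n \<ge> 1"
  shows "real n powr - (1 + \<epsilon>) \<le> ((real n - 1/2) powr - \<epsilon> - (real n + 1/2) powr - \<epsilon>) / \<epsilon>"
proof -
  define f where "f x = ((real n - x) powr - \<epsilon> - (real n + x) powr - \<epsilon>) / \<epsilon> - 2 * x * real n powr - (1 + \<epsilon>)" for x
  have "f 0 \<le> f (1/2)"
  proof (rule DERIV_nonneg_imp_nondecreasing[of 0 "1/2" f])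
    fix x :: real assume x: "0 \<le> x" "x \<le> 1/2"
    define a b where "a = real n - x" and "b = real n + x"
    have ab: "a > 0" "b > 0" using x n by (auto simp: a_def b_def)
    have "(f has_real_derivative a powr (- \<epsilon> - 1) + b powr (- \<epsilon> - 1) - 2 * real n powr - (1 + \<epsilon>)) (at x)"
      unfolding f_def using \<epsilon> ab by (auto intro!: derivative_eq_intros simp: a_def b_def field_simps)
    moreover have "2 * real n powr - (1 + \<epsilon>) \<le> a powr (- \<epsilon> - 1) + b powr (- \<epsilon> - 1)"
    proof -
      have "convex_on {0<..} (\<lambda>x::real. x powr - (1 + \<epsilon>))"
      proof (rule f''_ge0_imp_convex[where f' = "\<lambda>x. - (1 + \<epsilon>) * x powr (- (1 + \<epsilon>) - 1)"
            and f'' = "\<lambda>x. - (1 + \<epsilon>) * ((- (1 + \<epsilon>) - 1) * x powr (- (1 + \<epsilon>) - 1 - 1))"])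
        fix x :: real assume x: "x \<in> {0<..}"
        show "((\<lambda>x. x powr - (1 + \<epsilon>)) has_real_derivative - (1 + \<epsilon>) * x powr (- (1 + \<epsilon>) - 1)) (at x)"
          using x by (auto intro!: derivative_eq_intros)
        show "((\<lambda>x. - (1 + \<epsilon>) * x powr (- (1 + \<epsilon>) - 1)) has_real_derivative
            - (1 + \<epsilon>) * ((- (1 + \<epsilon>) - 1) * x powr (- (1 + \<epsilon>) - 1 - 1))) (at x)"
          using x by (auto intro!: derivative_eq_intros)
        show "0 \<le> - (1 + \<epsilon>) * ((- (1 + \<epsilon>) - 1) * x powr (- (1 + \<epsilon>) - 1 - 1))"
        proof -
          have eq: "- (1 + \<epsilon>) * ((- (1 + \<epsilon>) - 1) * t) = (1 + \<epsilon>) * (2 + \<epsilon>) * t" for t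
            by (simp add: algebra_simps)
          show ?thesis unfolding eq using \<epsilon> by simp
        qed
      qed auto
      from convex_onD[OF this, of "1/2" a b] ab
      have "((1/2) * a + (1/2) * b) powr - (1 + \<epsilon>) \<le> 1/2 * a powr - (1 + \<epsilon>) + 1/2 * b powr - (1 + \<epsilon>)" by simp
      moreover have "(1/2) * a + (1/2) * b = real n" by (simp add: a_def b_def field_simps)
      moreover have "- \<epsilon> - 1 = - (1 + \<epsilon>)" by simp
      ultimately show ?thesis by (simp only:)
    qed
    ultimately show "\<exists>y. DERIV f x :> y \<and> 0 \<le> y" by force
  qed simp
  then show ?thesis by (simp add: f_def)
qed

text \<open>The term n = 1 is kept exact. Applying the midpoint bound to it too would give
  2^\<epsilon> / \<epsilon>, and ln 2 exceeds Euler's constant; now the expansion at small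
  \<epsilon> is 1/\<epsilon> + 1 - ln(3/2), with constant term about 0.595 against 0.577.\<close>

lemma sum_powr_minus_le:
  fixes \<epsilon> :: real
  assumes \<epsilon>: "\<epsilon> > 0"
  shows "(\<Sum>n=1..N. real n powr - (1 + \<epsilon>)) \<le> 1 + (3/2) powr - \<epsilon> / \<epsilon>"
proof -
  have "(\<Sum>n=2..N. real n powr - (1 + \<epsilon>)) \<le> (3/2) powr - \<epsilon> / \<epsilon>"
  proof -
    have "(\<Sum>n=2..N. real n powr - (1 + \<epsilon>)) \<le> (3/2) powr - \<epsilon> / \<epsilon> - (real N + 1/2) powr - \<epsilon> / \<epsilon>" if "N \<ge> 1"
      using that
    proof (induction N rule: dec_induct)
      case (step n)
      have "(\<Sum>k=2..Suc n. real k powr - (1 + \<epsilon>)) = (\<Sum>k=2..n. real k powr - (1 + \<epsilon>)) + real (Suc n) powr - (1 + \<epsilon>)"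
        using step by simp
      moreover have "real (Suc n) - 1/2 = real n + 1/2" by simp
      then have "real (Suc n) powr - (1 + \<epsilon>)
          \<le> (real n + 1/2) powr - \<epsilon> / \<epsilon> - (real (Suc n) + 1/2) powr - \<epsilon> / \<epsilon>"
        using powr_minus_le_integral[OF \<epsilon>, of "Suc n"] by (simp only: diff_divide_distrib)
      ultimately show ?case using step.IH by linarith
    qed simp
    moreover have "0 \<le> (real N + 1/2) powr - \<epsilon> / \<epsilon>" "0 \<le> (3/2) powr - \<epsilon> / \<epsilon>" using \<epsilon> by auto
    ultimately show ?thesis by (cases "N \<ge> 1") auto
  qed
  moreover have "(\<Sum>n=1..N. real n powr - (1 + \<epsilon>)) \<le> 1 + (\<Sum>n=2..N. real n powr - (1 + \<epsilon>))"
  proof (cases "N \<ge> 1")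
    case True
    then show ?thesis using sum.atLeast_Suc_atMost[of 1 N "\<lambda>n. real n powr - (1 + \<epsilon>)"]
      by (simp add: numeral_2_eq_2)
  qed (auto simp: sum_nonneg)
  ultimately show ?thesis by linarith
qed

lemma exp_minus_le:
  fixes x :: real
  assumes "x \<ge> 0"
  shows "exp (- x) \<le> 1 - x + x\<^sup>2 / 2"
proof -
  define f where "f x = 1 - x + x\<^sup>2 / 2 - exp (- x)" for x :: real
  have "f 0 \<le> f x"
  proof (rule DERIV_nonneg_imp_nondecreasing[OF assms])
    fix t :: real assume "0 \<le> t"
    have "(f has_real_derivative - 1 + t + exp (- t)) (at t)"
      unfolding f_def by (auto intro!: derivative_eq_intros)
    moreover have "0 \<le> - 1 + t + exp (- t)" using exp_ge_add_one_self[of "- t"] by simp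
    ultimately show "\<exists>y. DERIV f t :> y \<and> 0 \<le> y" by blast
  qed
  then show ?thesis by (simp add: f_def)
qed

lemma zeta_bound:
  fixes \<epsilon> :: real
  assumes \<epsilon>: "\<epsilon> > 0"
  shows "1 + (3/2) powr - \<epsilon> / \<epsilon> \<le> 1.0018 * exp (euler_mascheroni * \<epsilon>) / \<epsilon>"
proof -
  have l: "ln (3/2::real) \<in> {0.405..0.406}"
    using ln_approx_bounds[of "3/2" 4] by (simp add: eval_nat_numeral)
  have "(3/2) powr - \<epsilon> = exp (- (ln (3/2) * \<epsilon>))" by (simp add: powr_def mult.commute)
  also have "\<dots> \<le> exp (- (0.405 * \<epsilon>))" using l \<epsilon> by simp
  also have "\<dots> \<le> 1 - 0.405 * \<epsilon> + (0.405 * \<epsilon>)\<^sup>2 / 2" using \<epsilon> by (intro exp_minus_le) auto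
  finally have 1: "\<epsilon> + (3/2) powr - \<epsilon> \<le> 1 + 0.595 * \<epsilon> + (0.405 * \<epsilon>)\<^sup>2 / 2" by simp
  have "1 + 0.5757 * \<epsilon> + (0.5757 * \<epsilon>)\<^sup>2 / 2 \<le> exp (0.5757 * \<epsilon>)" using \<epsilon> by (intro exp_lower_Taylor_quadratic) auto
  also have "\<dots> \<le> exp (euler_mascheroni * \<epsilon>)" using \<epsilon> euler_mascheroni_gt_19_over_33 by simp
  finally have 2: "1 + 0.5757 * \<epsilon> + (0.5757 * \<epsilon>)\<^sup>2 / 2 \<le> exp (euler_mascheroni * \<epsilon>)" .
  \<comment> \<open>The difference of the two quadratics has negative discriminant and its minimum
    is near \<epsilon> = 0.11; a multiple of this square, centred nearby, certifies the
    sign.\<close>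
  have "0 \<le> (0.0836 * \<epsilon> - 0.00965)\<^sup>2" by simp
  then have "1 + 0.595 * \<epsilon> + (0.405 * \<epsilon>)\<^sup>2 / 2 \<le> 1.0018 * (1 + 0.5757 * \<epsilon> + (0.5757 * \<epsilon>)\<^sup>2 / 2)"
    using \<epsilon> by (simp add: power2_eq_square field_simps)
  also have "\<dots> \<le> 1.0018 * exp (euler_mascheroni * \<epsilon>)" using 2 by (intro mult_left_mono) auto
  finally have "\<epsilon> + (3/2) powr - \<epsilon> \<le> 1.0018 * exp (euler_mascheroni * \<epsilon>)" using 1 by linarith
  then have "(\<epsilon> + (3/2) powr - \<epsilon>) / \<epsilon> \<le> 1.0018 * exp (euler_mascheroni * \<epsilon>) / \<epsilon>"
    using \<epsilon> by (intro divide_right_mono) auto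
  then show ?thesis using \<epsilon> by (simp add: add_divide_distrib)
qed

section \<open>A lower bound for a sum over primes\<close>

text \<open>A form of Legendre's formula for the exponent of p in N!: only the multiples of p
  contribute, and dividing them by p gives the same problem for \<open>N div p\<close>.\<close>

lemma sum_multiplicity_le:
  fixes p N :: nat
  assumes p: "prime p"
  shows "real (\<Sum>n=1..N. multiplicity p n) \<le> real N / (real p - 1)"
proof (induction N rule: less_induct)
  case (less N)
  have p1: "p > 1" using p prime_gt_1_nat by blast
  have eq: "(\<Sum>n=1..N. multiplicity p n) = N div p + (\<Sum>m=1..N div p. multiplicity p m)"
  proof -
    have "(\<Sum>n=1..N. multiplicity p n) = (\<Sum>n\<in>(*) p ` {1..N div p}. multiplicity p n)"
    proof (rule sum.mono_neutral_right)
      show "(*) p ` {1..N div p} \<subseteq> {1..N}"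
        using p1 by (auto simp: less_eq_div_iff_mult_less_eq mult.commute Suc_le_eq)
      show "\<forall>n\<in>{1..N} - (*) p ` {1..N div p}. multiplicity p n = 0"
      proof
        fix n assume n: "n \<in> {1..N} - (*) p ` {1..N div p}"
        have "\<not> p dvd n"
        proof
          assume "p dvd n"
          then obtain m where "n = p * m" by (elim dvdE)
          then show False using n p1 by (auto simp: less_eq_div_iff_mult_less_eq mult.commute Suc_le_eq)
        qed
        then show "multiplicity p n = 0" by (rule not_dvd_imp_multiplicity_0)
      qed
    qed auto
    also have "\<dots> = (\<Sum>m=1..N div p. Suc (multiplicity p m))"
      using p1 p by (subst sum.reindex) (auto simp: inj_on_def multiplicity_times_same intro!: sum.cong)
    finally show ?thesis by (simp add: sum_Suc)
  qed
  show ?case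
  proof (cases "N = 0")
    case False
    then have "N div p < N" using p1 by simp
    from less[OF this] have "real (\<Sum>n=1..N. multiplicity p n) \<le> real (N div p) + real (N div p) / (real p - 1)"
      unfolding eq by simp
    also have "\<dots> = real (N div p) * (real p / (real p - 1))" using p1 by (simp add: field_simps)
    also have "\<dots> \<le> real N / real p * (real p / (real p - 1))"
      using p1 by (intro mult_right_mono of_nat_div_le_of_nat) auto
    finally show ?thesis using p1 by simp
  qed simp
qed

lemma sum_ln_ge: "real N * ln (real N) - real N \<le> (\<Sum>n=1..N. ln (real n))"
proof (induction N)
  case (Suc N)
  show ?case
  proof (cases "N = 0")
    case False
    then have "ln ((real N + 1) / real N) \<le> (real N + 1) / real N - 1" by (intro ln_le_minus_one) auto
    then have "real N * ln ((real N + 1) / real N) \<le> real N * ((real N + 1) / real N - 1)"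
      by (intro mult_left_mono) auto
    then have "real N * (ln (real N + 1) - ln (real N)) \<le> 1" using False by (simp add: ln_div field_simps)
    with Suc show ?thesis by (simp add: algebra_simps)
  qed simp
qed simp

text \<open>Factoring N! into primes and comparing with N ln N - N. Replacing 1 / (p - 1) by 2 / p
  costs a factor 2, which the application can afford.\<close>

lemma mertens_lower:
  assumes N: "N \<ge> 1"
  shows "(ln (real N) - 1) / 2 \<le> (\<Sum>p | p \<in> {1..N} \<and> prime p. ln (real p) / real p)"
proof -
  let ?P = "{p. p \<in> {1..N} \<and> prime p}"
  have "ln (real n) = (\<Sum>p\<in>?P. real (multiplicity p n) * ln (real p))" if n: "n \<in> {1..N}" for n
  proof -
    have pf: "prime_factors n \<subseteq> ?P"
      using n by (auto simp: prime_factors_dvd prime_gt_0_nat Suc_le_eq dest: dvd_imp_le)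
    have "real n = real (\<Prod>p\<in>prime_factors n. p ^ multiplicity p n)"
      using n by (intro arg_cong[where f = real] prime_factorization_nat) auto
    then have "ln (real n) = ln (\<Prod>p\<in>prime_factors n. real p ^ multiplicity p n)" by simp
    also have "\<dots> = (\<Sum>p\<in>prime_factors n. ln (real p ^ multiplicity p n))"
      by (intro ln_prod) (auto dest!: in_prime_factors_imp_prime simp: prime_gt_0_nat)
    also have "\<dots> = (\<Sum>p\<in>prime_factors n. real (multiplicity p n) * ln (real p))"
      by (intro sum.cong) (auto simp: ln_realpow prime_gt_0_nat dest!: in_prime_factors_imp_prime)
    also have "\<dots> = (\<Sum>p\<in>?P. real (multiplicity p n) * ln (real p))"
      using pf n by (intro sum.mono_neutral_left) (auto simp: prime_factors_dvd not_dvd_imp_multiplicity_0)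
    finally show ?thesis .
  qed
  then have "(\<Sum>n=1..N. ln (real n)) = (\<Sum>n=1..N. \<Sum>p\<in>?P. real (multiplicity p n) * ln (real p))"
    by (rule sum.cong[OF refl])
  also have "\<dots> = (\<Sum>p\<in>?P. \<Sum>n=1..N. real (multiplicity p n) * ln (real p))"
    by (rule sum.swap)
  also have "\<dots> = (\<Sum>p\<in>?P. real (\<Sum>n=1..N. multiplicity p n) * ln (real p))"
    by (simp add: sum_distrib_right)
  also have "\<dots> \<le> (\<Sum>p\<in>?P. (2 * real N / real p) * ln (real p))"
  proof (intro sum_mono mult_right_mono)
    fix p assume p: "p \<in> ?P"
    then have p2: "real p \<ge> 2" using prime_ge_2_nat[of p] by simp
    have "real (\<Sum>n=1..N. multiplicity p n) \<le> real N / (real p - 1)"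
      using p by (intro sum_multiplicity_le) auto
    also have "\<dots> \<le> real N / (real p / 2)" using p2 by (intro divide_left_mono) auto
    finally show "real (\<Sum>n=1..N. multiplicity p n) \<le> 2 * real N / real p" by (simp add: mult.commute)
    show "0 \<le> ln (real p)" using p2 by simp
  qed
  also have "\<dots> = 2 * real N * (\<Sum>p\<in>?P. ln (real p) / real p)"
    by (simp add: sum_distrib_left)
  finally have "real N * (ln (real N) - 1) \<le> real N * (2 * (\<Sum>p\<in>?P. ln (real p) / real p))"
    using sum_ln_ge[of N] by (simp add: algebra_simps)
  then show ?thesis using N by simp
qed

lemma prime_log_sum_ge:
  fixes z :: real
  assumes z: "z \<ge> 100" "z < real M + 1"
  shows "0.0932 * (ln z)\<^sup>2 \<le> (\<Sum>p | p \<in> {1..M} \<and> prime p. ln (real p) / real p * log_plus (z / real p))"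
proof -
  define X where "X = ln z"
  let ?P = "\<lambda>N. {p. p \<in> {1..N} \<and> prime p}"
  let ?S = "\<Sum>p\<in>?P M. ln (real p) / real p * log_plus (z / real p)"
  have "ln (100::real) = 2 * (ln 2 + ln 5)" using ln_mult[of 10 10] ln_composites(5) by simp
  then have X: "X \<ge> 4.6"
    using z ln_mono[of 100 z] ln_2_3_5_7_11_bounds(1,3) by (simp add: X_def)
  have nonneg: "0 \<le> ln (real p) / real p * log_plus (z / real p)" if "p \<in> ?P M" for p
    using that by simp
  show ?thesis unfolding X_def[symmetric]
  proof (cases "X \<le> 9")
    case True
    \<comment> \<open>For z up to e^9 the primes 2, 3, 5 suffice; c and d stand for rational bounds
      of ln p / p from below and (ln p)^2 / p from above.\<close>
    have trm: "c * X - d \<le> ln (real p) / real p * log_plus (z / real p)"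
      if "p > 0" "c \<le> ln (real p) / real p" "ln (real p) / real p * ln (real p) \<le> d" "real p \<le> z" for p c d
    proof -
      have lp: "log_plus (z / real p) = X - ln (real p)"
        using that z by (simp add: log_plus_eq_ln ln_div X_def)
      have "ln (real p) / real p * log_plus (z / real p) = ln (real p) / real p * X - ln (real p) / real p * ln (real p)"
        unfolding lp by (rule right_diff_distrib)
      moreover have "c * X \<le> ln (real p) / real p * X" using that X by (intro mult_right_mono) auto
      ultimately show ?thesis using that by linarith
    qed
    have sq: "(ln (real p))\<^sup>2 \<le> b\<^sup>2" if "ln (real p) \<le> b" "p > 0" for p b
      using that by (intro power_mono) auto
    have "(0.3465 * X - 0.241) + (0.3661 * X - 0.403) + (0.3218 * X - 0.519)
      \<le> (\<Sum>p\<in>{2,3,5}. ln (real p) / real p * log_plus (z / real p))"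
      using trm[of 2 "0.3465" "0.241"] trm[of 3 "0.3661" "0.403"] trm[of 5 "0.3218" "0.519"] z
        ln_2_3_5_7_11_bounds(1,2,3) sq[of 2 "0.69315"] sq[of 3 "1.09862"] sq[of 5 "1.60945"]
      by (simp add: power2_eq_square)
    also have "\<dots> \<le> ?S"
    proof (rule sum_mono2)
      have "5 \<le> M" using z by linarith
      then show "{2,3,5} \<subseteq> ?P M" by auto
    qed (use nonneg in auto)
    finally have S: "1.0344 * X - 1.163 \<le> ?S" by simp
    \<comment> \<open>The chord of X^2 over [4.6, 9] makes the comparison with the linear bound
      linear.\<close>
    have "0 \<le> (X - 4.6) * (9 - X)" using X True by simp
    then have "X\<^sup>2 \<le> 13.6 * X - 41.4" by (simp add: field_simps power2_eq_square)
    then show "0.0932 * X\<^sup>2 \<le> ?S" using S True by simp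
  next
    case False
    \<comment> \<open>For larger z only primes up to sqrt z are used: each has ln(z/p) \<ge> X / 2,
      and the Mertens bound applies to the rest.\<close>
    define w where "w = sqrt z"
    define N where "N = nat \<lfloor>w\<rfloor>"
    have w: "w \<ge> 10" "w * w = z" using z real_le_rsqrt[of 10 z] by (auto simp: w_def)
    have lnw: "ln w = X / 2" using z by (simp add: w_def X_def ln_sqrt)
    have N: "real N \<le> w" "w - 1 < real N" "N \<ge> 1" using w by (auto simp: N_def le_nat_floor)
    have "w * 1 \<le> w * w" using w by (intro mult_left_mono) auto
    then have "real N < real (M + 1)" using N w z by simp
    then have NM: "N \<le> M" unfolding of_nat_less_iff by simp
    have "ln (10/9::real) \<le> 10/9 - 1" by (rule ln_le_minus_one) simp
    moreover have "ln (w * (9/10)) \<le> ln (real N)" using w N by (intro ln_mono) auto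
    moreover have "ln (w * (9/10)) = ln w - ln (10/9)" using w by (simp add: ln_mult ln_div)
    ultimately have lnN: "X / 2 - 1/9 \<le> ln (real N)" using lnw by linarith
    have "(X / 2 - 1/9 - 1) / 2 * (X / 2) \<le> (\<Sum>p\<in>?P N. ln (real p) / real p) * (X / 2)"
      using mertens_lower[OF N(3)] lnN X by (intro mult_right_mono) auto
    also have "\<dots> = (\<Sum>p\<in>?P N. ln (real p) / real p * (X / 2))" by (simp add: sum_distrib_right)
    also have "\<dots> \<le> (\<Sum>p\<in>?P N. ln (real p) / real p * log_plus (z / real p))"
    proof (intro sum_mono mult_left_mono)
      fix p assume p: "p \<in> ?P N"
      then have pw: "real p \<le> w" "real p > 0" using N by auto
      have "w \<le> z / real p" using pw w by (simp add: field_simps flip: w(2))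
      then have "ln w \<le> ln (z / real p)" using w by (intro ln_mono) auto
      then show "X / 2 \<le> log_plus (z / real p)" using lnw by (simp add: log_plus_def)
      show "0 \<le> ln (real p) / real p" using p by simp
    qed
    also have "\<dots> \<le> ?S"
      using nonneg NM by (intro sum_mono2) auto
    also have "(X / 2 - 1/9 - 1) / 2 * (X / 2) = X\<^sup>2 / 8 - 5/18 * X"
      by (simp add: field_simps power2_eq_square)
    finally have S: "X\<^sup>2 / 8 - 5/18 * X \<le> ?S" .
    have "9 * X \<le> X\<^sup>2" using False by (simp add: power2_eq_square)
    \<comment> \<open>At X = 9 the right side is (1/8 - 5/162) X^2, about 0.0941 X^2, and the ratio
      to X^2 increases with X.\<close>
    then have "0.0932 * X\<^sup>2 \<le> X\<^sup>2 / 8 - 5/18 * X" using False by simp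
    with S show "0.0932 * X\<^sup>2 \<le> ?S" by (rule order_trans[rotated])
  qed
qed

section \<open>The Barban--Vehov sum\<close>

lemma has_sum_finite_sum:
  fixes f :: "'i \<Rightarrow> 'a \<Rightarrow> real"
  assumes "finite I" "\<And>i. i \<in> I \<Longrightarrow> (f i has_sum a i) A"
  shows "((\<lambda>x. \<Sum>i\<in>I. f i x) has_sum (\<Sum>i\<in>I. a i)) A"
  using assms by (induction I rule: finite_induct) (auto intro: has_sum_add)

lemma powr_minus_summable_on:
  fixes \<epsilon> :: real
  assumes \<epsilon>: "\<epsilon> > 0"
  shows "(\<lambda>n. real n powr - (1 + \<epsilon>)) summable_on {1..}"
    and "(\<Sum>\<^sub>\<infinity>n\<in>{1..}. real n powr - (1 + \<epsilon>)) \<le> 1.0018 * exp (euler_mascheroni * \<epsilon>) / \<epsilon>"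
proof -
  have le: "(\<Sum>n\<in>F. real n powr - (1 + \<epsilon>)) \<le> 1 + (3/2) powr - \<epsilon> / \<epsilon>" if "finite F" "F \<subseteq> {1..}" for F :: "nat set"
  proof -
    have "F \<subseteq> {1..Max F}" using that by auto
    then have "(\<Sum>n\<in>F. real n powr - (1 + \<epsilon>)) \<le> (\<Sum>n=1..Max F. real n powr - (1 + \<epsilon>))"
      by (intro sum_mono2) auto
    also have "\<dots> \<le> 1 + (3/2) powr - \<epsilon> / \<epsilon>" by (rule sum_powr_minus_le[OF \<epsilon>])
    finally show ?thesis .
  qed
  show *: "(\<lambda>n. real n powr - (1 + \<epsilon>)) summable_on {1..}"
    using le by (intro nonneg_bdd_above_summable_on bdd_aboveI2) auto
  have "(\<Sum>\<^sub>\<infinity>n\<in>{1..}. real n powr - (1 + \<epsilon>)) \<le> 1 + (3/2) powr - \<epsilon> / \<epsilon>"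
    using * le by (rule infsum_le_finite_sums)
  also have "\<dots> \<le> 1.0018 * exp (euler_mascheroni * \<epsilon>) / \<epsilon>" by (rule zeta_bound[OF \<epsilon>])
  finally show "(\<Sum>\<^sub>\<infinity>n\<in>{1..}. real n powr - (1 + \<epsilon>)) \<le> 1.0018 * exp (euler_mascheroni * \<epsilon>) / \<epsilon>" .
qed

lemma has_sum_multiples:
  fixes D :: nat
  assumes D: "D \<ge> 1" and Z: "((\<lambda>n. real n powr - s) has_sum Z) {1..}"
  shows "((\<lambda>n. if D dvd n then real n powr - s else 0) has_sum real D powr - s * Z) {1..}"
proof -
  have "((\<lambda>n. real D powr - s * real n powr - s) has_sum real D powr - s * Z) {1..}"
    using Z by (rule has_sum_cmult_right)
  moreover have "(\<lambda>n. real D powr - s * real n powr - s) = (\<lambda>n. real n powr - s) \<circ> (*) D"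
    by (auto simp: powr_mult)
  ultimately have "((\<lambda>n. real n powr - s) has_sum real D powr - s * Z) ((*) D ` {1..})"
    using D by (subst has_sum_reindex) (auto simp: inj_on_def)
  then show ?thesis
  proof (rule has_sum_cong_neutral[THEN iffD1, rotated -1], goal_cases)
    case (1 n)
    then have "n \<ge> 1" "n \<notin> (*) D ` {1..}" by auto
    then have "\<not> D dvd n" by (auto elim!: dvdE simp: Suc_le_eq)
    then show ?case by simp
  qed (use D in \<open>auto simp: Suc_le_eq\<close>)
qed

text \<open>After opening the square, the pair d, e collects the n divisible by lcm(d, e), whose
  total is lcm(d, e)^(-s) Z. Both sums over divisors are finite, so no convergence question beyond Z
  arises.\<close>

lemma has_sum_divisor_sum_sq:
  fixes w :: "nat \<Rightarrow> real"
  assumes w: "\<And>d. \<not> squarefree d \<Longrightarrow> w d = 0" "\<And>d. M < d \<Longrightarrow> w d = 0"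
    and Z: "((\<lambda>n. real n powr - s) has_sum Z) {1..}"
  shows "((\<lambda>n. real n powr - s * (\<Sum>d | d dvd n. w d)\<^sup>2) has_sum
    (\<Sum>r=1..M. jordan s r * (\<Sum>d | d \<in> {1..M} \<and> r dvd d. w d * real d powr - s)\<^sup>2) * Z) {1..}"
proof -
  have diag: "(\<Sum>d=1..M. \<Sum>e=1..M. w d * w e * real (lcm d e) powr - s)
    = (\<Sum>r=1..M. jordan s r * (\<Sum>d | d \<in> {1..M} \<and> r dvd d. w d * real d powr - s)\<^sup>2)"
    by (rule quadratic_form_diagonal) (rule w(1))
  have "((\<lambda>n. \<Sum>d=1..M. \<Sum>e=1..M. w d * w e * (if lcm d e dvd n then real n powr - s else 0))
    has_sum (\<Sum>d=1..M. \<Sum>e=1..M. w d * w e * (real (lcm d e) powr - s * Z))) {1..}"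
    by (intro has_sum_finite_sum has_sum_cmult_right has_sum_multiples Z) (auto simp: Suc_le_eq lcm_pos_nat)
  also have "(\<Sum>d=1..M. \<Sum>e=1..M. w d * w e * (real (lcm d e) powr - s * Z))
    = (\<Sum>r=1..M. jordan s r * (\<Sum>d | d \<in> {1..M} \<and> r dvd d. w d * real d powr - s)\<^sup>2) * Z"
    unfolding diag[symmetric]
    unfolding sum_distrib_right by (simp add: mult.assoc)
  finally show ?thesis
  proof (rule has_sum_cong[THEN iffD1, rotated], goal_cases)
    case (1 n)
    have eq: "(\<Sum>d | d dvd n. w d) = (\<Sum>d=1..M. if d dvd n then w d else 0)"
    proof -
      have "(\<Sum>d | d dvd n. w d) = (\<Sum>d | d \<in> {1..M} \<and> d dvd n. w d)"
      proof (rule sum.mono_neutral_right)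
        show "\<forall>d\<in>{d. d dvd n} - {d. d \<in> {1..M} \<and> d dvd n}. w d = 0"
        proof
          fix d assume d: "d \<in> {d. d dvd n} - {d. d \<in> {1..M} \<and> d dvd n}"
          then have "d > 0" using 1 by (auto intro: dvd_pos_nat)
          then show "w d = 0" using d by (intro w(2)) auto
        qed
      qed (use 1 in auto)
      then show ?thesis by (simp only: sum.inter_filter[OF finite_atLeastAtMost])
    qed
    have "real n powr - s * (\<Sum>d | d dvd n. w d)\<^sup>2
        = (\<Sum>d=1..M. \<Sum>e=1..M. real n powr - s * ((if d dvd n then w d else 0) * (if e dvd n then w e else 0)))"
      unfolding eq power2_eq_square sum_product unfolding sum_distrib_left by (rule refl)
    also have "\<dots> = (\<Sum>d=1..M. \<Sum>e=1..M. w d * w e * (if lcm d e dvd n then real n powr - s else 0))"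
      by (intro sum.cong refl) (auto simp: lcm_least_iff)
    finally show ?case by simp
  qed
qed

lemma quadratic_form_bound:
  fixes \<epsilon> z :: real
  assumes \<epsilon>: "\<epsilon> > 0" and z: "z \<ge> 100" "z < real M + 1"
  shows "1.0018 * (\<Sum>r | r \<in> {1..M} \<and> squarefree r. jordan (1 + \<epsilon>) r * (real r powr - (1 + \<epsilon>) * coprime_log_sum (prime_factors r) M (1 + \<epsilon>) (z / real r))\<^sup>2)
    \<le> 1.084 * ln z + (1.301 - 0.318 / z powr \<epsilon>) * \<epsilon> * (ln z)\<^sup>2"
proof -
  define X y where "X = ln z" and "y = z powr - \<epsilon>"
  define P where "P = (\<Sum>p | p \<in> {1..M} \<and> prime p. real p powr - (1 + \<epsilon>) * log_plus (z / real p) * ln (real p))"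
  have X: "X \<ge> 0" using z by (simp add: X_def)
  have y: "0 \<le> y" "0.318 / z powr \<epsilon> = 0.318 * y"
    by (simp_all add: y_def powr_minus_divide)
  have "z powr - \<epsilon> \<le> 1 powr - \<epsilon>" using z \<epsilon> by (intro powr_mono2') linarith+
  also have "1 powr - \<epsilon> = (1::real)" by (rule powr_one_eq_one)
  finally have y1: "y \<le> 1" by (simp only: y_def)
  have "y * (0.0932 * X\<^sup>2) \<le> y * (\<Sum>p | p \<in> {1..M} \<and> prime p. ln (real p) / real p * log_plus (z / real p))"
    using prime_log_sum_ge[OF z] y(1) by (intro mult_left_mono) (auto simp: X_def)
  also have "\<dots> = (\<Sum>p | p \<in> {1..M} \<and> prime p. y * (ln (real p) / real p * log_plus (z / real p)))"
    by (rule sum_distrib_left)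
  also have "\<dots> \<le> P" unfolding P_def
  proof (intro sum_mono)
    fix p assume p: "p \<in> {p. p \<in> {1..M} \<and> prime p}"
    show "y * (ln (real p) / real p * log_plus (z / real p)) \<le> real p powr - (1 + \<epsilon>) * log_plus (z / real p) * ln (real p)"
    proof (cases "real p \<le> z")
      case True
      \<comment> \<open>Every prime with a nonzero term is at most z, hence p^(-\<epsilon>) \<ge>
        z^(-\<epsilon>); this produces the form C / z^\<epsilon> of the saving.\<close>
      then have "y \<le> real p powr - \<epsilon>" using p \<epsilon> by (auto simp: y_def intro: powr_mono2')
      then have "y * (ln (real p) / real p * log_plus (z / real p)) \<le> real p powr - \<epsilon> * (ln (real p) / real p * log_plus (z / real p))"
        using p by (intro mult_right_mono) auto
      also have "\<dots> = real p powr - (1 + \<epsilon>) * log_plus (z / real p) * ln (real p)"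
      proof -
        have e: "- (1 + \<epsilon>) = - \<epsilon> - 1" by simp
        have "real p powr - (1 + \<epsilon>) = real p powr - \<epsilon> / real p"
          unfolding e using p by (simp add: powr_diff)
        then show ?thesis by simp
      qed
      finally show ?thesis .
    next
      case False
      then have "log_plus (z / real p) = 0" using p z by (intro log_plus_eq_0) auto
      then show ?thesis by simp
    qed
  qed
  finally have P: "y * (0.0932 * X\<^sup>2) \<le> P" .
  have eX: "0 \<le> \<epsilon> * X\<^sup>2" using \<epsilon> by simp
  have "(\<Sum>r | r \<in> {1..M} \<and> squarefree r. jordan (1 + \<epsilon>) r * (real r powr - (1 + \<epsilon>) * coprime_log_sum (prime_factors r) M (1 + \<epsilon>) (z / real r))\<^sup>2)
    \<le> 1.082 * (X * (1 + \<epsilon> * X) - \<epsilon> * P)"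
    using sum_jordan_coprime_log_sum_sq[OF \<epsilon>, of z M] z by (simp add: X_def P_def)
  also have "\<dots> \<le> 1.082 * (X * (1 + \<epsilon> * X) - \<epsilon> * (y * (0.0932 * X\<^sup>2)))"
    using P \<epsilon> by (intro mult_left_mono diff_left_mono) auto
  also have "\<dots> = 1.082 * X + (1.082 - 1.082 * 0.0932 * y) * (\<epsilon> * X\<^sup>2)"
    by (simp add: algebra_simps power2_eq_square)
  finally have "1.0018 * (\<Sum>r | r \<in> {1..M} \<and> squarefree r. jordan (1 + \<epsilon>) r * (real r powr - (1 + \<epsilon>) * coprime_log_sum (prime_factors r) M (1 + \<epsilon>) (z / real r))\<^sup>2)
    \<le> 1.0018 * (1.082 * X + (1.082 - 1.082 * 0.0932 * y) * (\<epsilon> * X\<^sup>2))" by (rule mult_left_mono) simp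
  also have "\<dots> = 1.0018 * 1.082 * X + 1.0018 * (1.082 - 1.082 * 0.0932 * y) * (\<epsilon> * X\<^sup>2)"
    by (simp only: distrib_left mult.assoc)
  \<comment> \<open>Both coefficients of \<epsilon> X^2 are affine in y on [0, 1]. The tight end is
    y = 1, with about 0.98292 against 1.301 - 0.318 = 0.983; this fixes how large 0.0932 has to
    be.\<close>
  also have "\<dots> \<le> 1.084 * X + (1.301 - 0.318 * y) * (\<epsilon> * X\<^sup>2)"
    using X eX y(1) y1 by (intro add_mono mult_right_mono) auto
  finally show ?thesis unfolding y(2) by (simp add: X_def mult.assoc)
qed

theorem theorem1p1:
  fixes \<epsilon> z1 z2 \<tau> A B C :: real
  assumes "\<epsilon> > 0" and "z1 \<ge> 100" and "\<tau> > 1" and "z2 = z1 powr \<tau>"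
    and "A = 1.084" and "B = 1.301" and "C = 0.318"
  shows "(\<lambda>n::nat. 1 / real n powr (1 + \<epsilon>) * (\<Sum>d | d dvd n. barban_vehov z1 z2 d)\<^sup>2)
           summable_on {1..}
       \<and> (\<Sum>\<^sub>\<infinity>n::nat\<in>{1..}. 1 / real n powr (1 + \<epsilon>) * (\<Sum>d | d dvd n. barban_vehov z1 z2 d)\<^sup>2)
           \<le> exp (euler_mascheroni * \<epsilon>) / (\<epsilon> * ln (z2 / z1))
               * ((A * (\<tau> + 1)
                   + (B - C / z1 powr \<epsilon> + (B - C / z2 powr \<epsilon>) * \<tau>\<^sup>2) * \<epsilon> * ln z1)
                  / (\<tau> - 1))"
proof -
  define s where "s = 1 + \<epsilon>"
  define X where "X = ln z1"
  define L where "L = ln (z2 / z1)"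
  \<comment> \<open>One cut-off serves both levels: z1 and z2 lie below M + 1, so sums over {1..M}
    contain all nonzero terms of either.\<close>
  define M where "M = nat \<lfloor>z2\<rfloor>"
  define w where "w = barban_vehov z1 z2"
  define Z where "Z = (\<Sum>\<^sub>\<infinity>n\<in>{1..}. real n powr - s)"
  define Q where "Q = (\<Sum>r=1..M. jordan s r * (\<Sum>d | d \<in> {1..M} \<and> r dvd d. w d * real d powr - s)\<^sup>2)"
  define h where "h z r = coprime_log_sum (prime_factors r) M s (z / real r)" for z r
  define T where "T z = (\<Sum>r | r \<in> {1..M} \<and> squarefree r. jordan s r * (real r powr - s * h z r)\<^sup>2)" for z
  note \<epsilon> = assms(1) and z1 = assms(2) and \<tau> = assms(3)
  have X: "X > 0" using z1 by (simp add: X_def)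
  have lnz2: "ln z2 = \<tau> * X" using assms by (simp add: X_def ln_powr)
  have "z1 powr 1 < z1 powr \<tau>" using z1 \<tau> by (intro powr_less_mono) auto
  then have z12: "z1 < z2" using assms by simp
  have L: "L = (\<tau> - 1) * X" using z1 z12 lnz2 by (simp add: L_def ln_div X_def algebra_simps)
  have Lpos: "L > 0" using L X \<tau> by simp
  have M: "z2 < real M + 1" "z1 < real M + 1" using z12 z1 by (simp_all add: M_def) linarith+
  have w_eq: "w d = (moebius_mu d * log_plus (z2 / real d) - moebius_mu d * log_plus (z1 / real d)) / L" for d
    by (simp add: w_def barban_vehov_def L_def algebra_simps diff_divide_distrib)
  have w0: "w d = 0" if "\<not> squarefree d" for d
    using that by (simp add: w_eq moebius_mu_not_squarefree)
  have wM: "w d = 0" if "M < d" for d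
  proof -
    have "real (M + 1) \<le> real d" using that by (intro of_nat_mono) simp
    then have "log_plus (z2 / real d) = 0" "log_plus (z1 / real d) = 0"
      using M z1 z12 by (auto intro!: log_plus_eq_0 simp: divide_le_eq)
    then show ?thesis by (simp add: w_eq)
  qed
  have Z: "((\<lambda>n. real n powr - s) has_sum Z) {1..}"
    unfolding Z_def s_def using powr_minus_summable_on(1)[OF \<epsilon>] by (rule has_sum_infsum)
  have "((\<lambda>n. real n powr - s * (\<Sum>d | d dvd n. w d)\<^sup>2) has_sum Q * Z) {1..}"
    unfolding Q_def by (rule has_sum_divisor_sum_sq[OF _ _ Z]) (fact w0, fact wM)
  then have sum: "((\<lambda>n. 1 / real n powr (1 + \<epsilon>) * (\<Sum>d | d dvd n. barban_vehov z1 z2 d)\<^sup>2) has_sum Q * Z) {1..}"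
    by (simp only: powr_minus_divide s_def w_def)

  have T0: "0 \<le> T z" for z
    unfolding T_def s_def using \<epsilon> by (intro sum_nonneg mult_nonneg_nonneg less_imp_le[OF jordan_pos]) auto
  have Q0: "0 \<le> Q"
    unfolding Q_def s_def using \<epsilon> by (intro sum_nonneg mult_nonneg_nonneg less_imp_le[OF jordan_pos]) auto
  have "Q = (\<Sum>r | r \<in> {1..M} \<and> squarefree r. jordan s r * (\<Sum>d | d \<in> {1..M} \<and> r dvd d. w d * real d powr - s)\<^sup>2)"
    unfolding Q_def
  proof (rule sum.mono_neutral_right)
    show "\<forall>r\<in>{1..M} - {r. r \<in> {1..M} \<and> squarefree r}.
        jordan s r * (\<Sum>d | d \<in> {1..M} \<and> r dvd d. w d * real d powr - s)\<^sup>2 = 0"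
    proof
      fix r assume "r \<in> {1..M} - {r. r \<in> {1..M} \<and> squarefree r}"
      then have "w d = 0" if "r dvd d" for d using w0 squarefree_mono that by blast
      then show "jordan s r * (\<Sum>d | d \<in> {1..M} \<and> r dvd d. w d * real d powr - s)\<^sup>2 = 0" by simp
    qed
  qed auto
  also have "\<dots> \<le> (\<Sum>r | r \<in> {1..M} \<and> squarefree r.
      (jordan s r * (real r powr - s * h z2 r)\<^sup>2 + jordan s r * (real r powr - s * h z1 r)\<^sup>2) / L\<^sup>2)"
  proof (intro sum_mono)
    fix r assume r: "r \<in> {r. r \<in> {1..M} \<and> squarefree r}"
    have hnonneg: "0 \<le> h z r" if "0 < z" "z < real M + 1" for z
    proof -
      have "z / real r \<le> z" using r that by (simp add: divide_le_eq)
      then show ?thesis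
        using coprime_log_sum_bounds[OF \<epsilon>, of "prime_factors r" "z / real r" M] r that
        by (auto simp: h_def s_def dest: in_prime_factors_imp_prime)
    qed
    let ?a = "real r powr - s * h z2 r" and ?b = "real r powr - s * h z1 r"
    have "(\<Sum>d | d \<in> {1..M} \<and> r dvd d. w d * real d powr - s)
        = ((\<Sum>d | d \<in> {1..M} \<and> r dvd d. moebius_mu d * log_plus (z2 / real d) * real d powr - s)
          - (\<Sum>d | d \<in> {1..M} \<and> r dvd d. moebius_mu d * log_plus (z1 / real d) * real d powr - s)) / L"
      unfolding w_eq sum_subtractf[symmetric] sum_divide_distrib
      by (intro sum.cong refl) (simp add: algebra_simps)
    also have "\<dots> = (moebius_mu r * ?a - moebius_mu r * ?b) / L"
      using r z1 z12 M sum_multiples_moebius_log_plus[of r z1 M s] sum_multiples_moebius_log_plus[of r z2 M s]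
      by (simp add: h_def mult.assoc)
    also have "\<dots> = moebius_mu r * (?a - ?b) / L" by (simp only: right_diff_distrib)
    finally have "(\<Sum>d | d \<in> {1..M} \<and> r dvd d. w d * real d powr - s)\<^sup>2 = (moebius_mu r * moebius_mu r) * (?a - ?b)\<^sup>2 / L\<^sup>2"
      by (simp add: power2_eq_square mult_ac)
    also have "\<dots> = (?a - ?b)\<^sup>2 / L\<^sup>2" using r by (simp add: moebius_mu_sq)
    also have "\<dots> \<le> (?a\<^sup>2 + ?b\<^sup>2) / L\<^sup>2"
    proof -
      \<comment> \<open>Nonnegativity at both levels makes the cross term -2ab of the square
        favourable.\<close>
      have "0 \<le> ?a * ?b" using hnonneg[of z1] hnonneg[of z2] M z1 z12 by simp
      then have "(?a - ?b)\<^sup>2 \<le> ?a\<^sup>2 + ?b\<^sup>2" unfolding power2_diff by linarith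
      then show ?thesis by (intro divide_right_mono) auto
    qed
    finally have "jordan s r * (\<Sum>d | d \<in> {1..M} \<and> r dvd d. w d * real d powr - s)\<^sup>2 \<le> jordan s r * ((?a\<^sup>2 + ?b\<^sup>2) / L\<^sup>2)"
      using \<epsilon> jordan_pos[of s r] by (intro mult_left_mono) (auto simp: s_def)
    then show "jordan s r * (\<Sum>d | d \<in> {1..M} \<and> r dvd d. w d * real d powr - s)\<^sup>2
        \<le> (jordan s r * ?a\<^sup>2 + jordan s r * ?b\<^sup>2) / L\<^sup>2"
      by (simp only: distrib_left times_divide_eq_right)
  qed
  also have "\<dots> = (T z2 + T z1) / L\<^sup>2"
    by (simp only: T_def sum.distrib sum_divide_distrib[symmetric])
  finally have Q: "Q \<le> (T z2 + T z1) / L\<^sup>2" .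

  define R where "R z = 1.084 * ln z + (1.301 - 0.318 / z powr \<epsilon>) * \<epsilon> * (ln z)\<^sup>2" for z
  have T: "1.0018 * T z \<le> R z" if "z \<ge> 100" "z < real M + 1" for z
    using quadratic_form_bound[OF \<epsilon> that] by (simp only: T_def h_def s_def R_def)
  have "Q * Z \<le> Q * (1.0018 * exp (euler_mascheroni * \<epsilon>) / \<epsilon>)"
    using powr_minus_summable_on(2)[OF \<epsilon>] Q0 by (intro mult_left_mono) (auto simp: Z_def s_def)
  also have "\<dots> \<le> (T z2 + T z1) / L\<^sup>2 * (1.0018 * exp (euler_mascheroni * \<epsilon>) / \<epsilon>)"
    using Q \<epsilon> by (intro mult_right_mono) auto
  also have "\<dots> = exp (euler_mascheroni * \<epsilon>) / (\<epsilon> * L\<^sup>2) * (1.0018 * T z2 + 1.0018 * T z1)"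
    by (simp add: field_simps)
  also have "\<dots> \<le> exp (euler_mascheroni * \<epsilon>) / (\<epsilon> * L\<^sup>2) * (R z2 + R z1)"
    using T[of z1] T[of z2] z1 z12 M \<epsilon> by (intro mult_left_mono add_mono) auto
  also have "R z2 + R z1 = X * (A * (\<tau> + 1) + (B - C / z1 powr \<epsilon> + (B - C / z2 powr \<epsilon>) * \<tau>\<^sup>2) * \<epsilon> * X)"
    unfolding R_def lnz2 X_def[symmetric] assms(5-7) by (simp add: algebra_simps power2_eq_square)
  also have "exp (euler_mascheroni * \<epsilon>) / (\<epsilon> * L\<^sup>2)
      * (X * (A * (\<tau> + 1) + (B - C / z1 powr \<epsilon> + (B - C / z2 powr \<epsilon>) * \<tau>\<^sup>2) * \<epsilon> * X))
    = exp (euler_mascheroni * \<epsilon>) / (\<epsilon> * L)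
      * ((A * (\<tau> + 1) + (B - C / z1 powr \<epsilon> + (B - C / z2 powr \<epsilon>) * \<tau>\<^sup>2) * \<epsilon> * X) / (\<tau> - 1))"
  proof -
    \<comment> \<open>One of the two factors L = (\<tau> - 1) X absorbs the X pulled out of
      \<open>R z2 + R z1\<close> and leaves the denominator \<tau> - 1.\<close>
    have "e / (\<epsilon> * L\<^sup>2) * (X * t) = e / (\<epsilon> * L) * (t / (\<tau> - 1))" for e t
      using X \<tau> \<epsilon> unfolding L by (simp add: power2_eq_square)
    then show ?thesis .
  qed
  finally show ?thesis
    using sum by (auto simp: has_sum_iff X_def L_def)
qed

end
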